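(* Let $f:\mathbb{R}^d\to\mathbb{R}$ be $L_0$-Lipschitz continuous, $L$-smooth and convex, with minimizer $x^*$. Run the deterministic one-point residual feedback algorithm from $x_1$ for $T$ iterations with $$\eta=\frac{\alpha}{4dL_0},\qquad \alpha=\|x_1-x^*\|^{2/3}\left(\frac{dL_0}{TL}\right)^{1/3}.$$ Let $\varepsilon>0$. If the iteration number satisfies $T\ge 2^{12}\|x_1-x^*\|^2 d^4\left(\frac{L}{L_0}\right)^2$ and $$T\ \ge\ \max\left\{10^{3/2}\,\|x_1-x^*\|^2 L_0L^{1/2}\cdot\frac{d}{\varepsilon^{3/2}},\ \ \frac{8^{3/4}L_0\|x_1-x^*\|^{1/2}}{L^{1/4}}\cdot\frac{d^{1/4}}{\varepsilon^{3/4}}\right\},$$ then $$\frac1T\sum_{t=1}^T\mathbb{E}\big[f(x_t)-f(x^* )\big]\le\varepsilon .$$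
   Context: $\|\cdot\|$ is the Euclidean norm on $\mathbb{R}^d$, $d\ge1$. A function $f$ is $L_0$-Lipschitz continuous ($L_0>0$) if $|f(x)-f(y)|\le L_0\|x-y\|$ for all $x,y$; it is $L$-smooth ($L>0$) if it is differentiable and $\|\nabla f(x)-\nabla f(y)\|\le L\|x-y\|$ for all $x,y$. $x^*$ denotes a minimizer of $f$ over $\mathbb{R}^d$. Deterministic one-point residual feedback algorithm: given an initial point $x_1\in\mathbb{R}^d$, step size $\eta>0$, smoothing parameter $\alpha>0$ and iteration number $T$, set $x_0=x_1$, let $u_0,u_1,\dots,u_T$ be independent and uniformly distributed on the unit sphere of $\mathbb{R}^d$, and for $t=1,\dots,T$ put $$g_t=d\cdot\frac{f(x_t+\alpha u_t)-f(x_{t-1}+\alpha u_{t-1})}{\alpha}\,u_t,\qquad x_{t+1}=x_t-\eta g_t .$$ Each iteration uses one new function evaluation, so the number of iterations is the sample complexity. Expectations are over all the $u_t$. *)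

theory Defs
  imports "HOL-Probability.Probability"
begin

definition smooth_fun :: "real \<Rightarrow> ('a::euclidean_space \<Rightarrow> real) \<Rightarrow> bool" where
  "smooth_fun L f \<longleftrightarrow> (\<exists>G. (\<forall>x. GDERIV f x :> G x) \<and> L-lipschitz_on UNIV G)"

text \<open>The library has no surface measure on spheres. In polar coordinates the normalised surface
  measure is the law of the direction of a uniformly distributed point of the unit ball:
  \<open>\<sigma>(A) = \<lambda>{x \<in> B. x / |x| \<in> A} / \<lambda>(B)\<close>. The value at the origin is irrelevant.\<close>

definition uniform_sphere :: "'a::euclidean_space measure" where
  "uniform_sphere = distr (uniform_measure lborel (ball 0 1)) borel (\<lambda>x. x /\<^sub>R norm x)"

lemma prob_space_uniform_sphere: "prob_space (uniform_sphere :: 'a::euclidean_space measure)"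
proof -
  have "emeasure lborel (ball (0::'a) 1) \<noteq> 0"
    by (simp add: emeasure_ball less_imp_neq[THEN not_sym])
  then have "prob_space (uniform_measure lborel (ball (0::'a) 1))"
    using emeasure_lborel_ball_finite[of "0::'a" 1]
    by (intro prob_space_uniform_measure) auto
  then show ?thesis
    unfolding uniform_sphere_def by (rule prob_space.prob_space_distr) simp
qed

lemma AE_uniform_sphere: "AE u in (uniform_sphere :: 'a::euclidean_space measure). norm u = 1"
proof -
  have "AE x in lborel. (x::'a) \<noteq> 0"
    by (rule AE_lborel_singleton)
  then have "AE x in uniform_measure lborel (ball (0::'a) 1). x \<noteq> 0"
    by (intro AE_uniform_measureI) auto
  then have "AE x in uniform_measure lborel (ball (0::'a) 1). norm (x /\<^sub>R norm x) = 1"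
    by eventually_elim simp
  then show ?thesis
    unfolding uniform_sphere_def by (subst AE_distr_iff) auto
qed

lemma uniform_sphere_orthogonal:
  fixes R :: "real ^ 'n::{finite,wellorder} \<Rightarrow> real ^ 'n::_"
  assumes "orthogonal_transformation R"
  shows "distr uniform_sphere borel R = uniform_sphere"
proof (rule measure_eqI)
  fix A :: "(real ^ 'n::_) set"
  assume "A \<in> sets (distr uniform_sphere borel R)"
  then have A [measurable]: "A \<in> sets borel" by simp
  have R [measurable]: "R \<in> borel_measurable borel"
    using assms by (intro borel_measurable_continuous_onI linear_continuous_on)
      (simp add: linear_conv_bounded_linear[symmetric] orthogonal_transformation_linear)
  have nR: "norm (R x) = norm x" for x
    using assms by (simp add: orthogonal_transformation)
  have linR: "R (c *\<^sub>R x) = c *\<^sub>R R x" for c x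
    using assms by (simp add: orthogonal_transformation_def linear_scale)
  have bijR: "bij R"
    using assms by (rule orthogonal_transformation_bij)
  define B where "B = ball 0 1 \<inter> {x :: real ^ 'n::_. x /\<^sub>R norm x \<in> A}"
  have B [measurable]: "B \<in> sets borel" unfolding B_def by measurable
  have "emeasure lborel B \<le> emeasure lborel (ball (0 :: real ^ 'n::_) 1)"
    by (intro emeasure_mono) (auto simp: B_def)
  then have finB: "emeasure lborel B < \<infinity>"
    using emeasure_lborel_ball_finite[of "0 :: real ^ 'n::_" 1] by (rule le_less_trans)
  then have Bm: "B \<in> lmeasurable"
    using B by (auto simp: fmeasurable_def)
  have vi: "R -` B = inv R ` B"
    using bijR by (simp add: bij_vimage_eq_inv_image)
  have oinv: "orthogonal_transformation (inv R)"
    using assms by (rule orthogonal_transformation_inv)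
  have "R -` B \<in> lmeasurable" "measure lebesgue (R -` B) = measure lebesgue B"
    unfolding vi using measurable_orthogonal_image[OF oinv Bm] measure_orthogonal_image[OF oinv Bm]
    by auto
  then have "emeasure lebesgue (R -` B) = emeasure lebesgue B"
    using Bm by (simp add: emeasure_eq_measure2)
  moreover have RB: "R -` B \<in> sets borel"
    using measurable_sets[OF R B] by simp
  ultimately have eq: "emeasure lborel (R -` B) = emeasure lborel B"
    using B by simp
  have "ball 0 1 \<inter> {x. R (x /\<^sub>R norm x) \<in> A} = R -` B"
    by (auto simp: B_def nR linR)
  then have "emeasure (distr uniform_sphere borel R) A =
      emeasure lborel (R -` B) / emeasure lborel (ball (0 :: real ^ 'n::_) 1)"
    unfolding uniform_sphere_def by (simp add: distr_distr emeasure_distr vimage_def)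
  also have "\<dots> = emeasure uniform_sphere A"
    unfolding eq by (simp add: uniform_sphere_def emeasure_distr vimage_def B_def)
  finally show "emeasure (distr uniform_sphere borel R) A = emeasure uniform_sphere A" .
qed (simp add: uniform_sphere_def)

definition residual_estimate ::
  "('a::euclidean_space \<Rightarrow> real) \<Rightarrow> real \<Rightarrow> 'a \<Rightarrow> 'a \<Rightarrow> 'a \<Rightarrow> 'a \<Rightarrow> 'a" where
  "residual_estimate f \<alpha> x u x' u' =
     (real DIM('a) * ((f (x + \<alpha> *\<^sub>R u) - f (x' + \<alpha> *\<^sub>R u')) / \<alpha>)) *\<^sub>R u"

fun residual_iterate ::
  "('a::euclidean_space \<Rightarrow> real) \<Rightarrow> 'a \<Rightarrow> real \<Rightarrow> real \<Rightarrow> (nat \<Rightarrow> 'a) \<Rightarrow> nat \<Rightarrow> 'a" where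
  "residual_iterate f x\<^sub>1 \<eta> \<alpha> u 0 = x\<^sub>1"
| "residual_iterate f x\<^sub>1 \<eta> \<alpha> u (Suc 0) = x\<^sub>1"
| "residual_iterate f x\<^sub>1 \<eta> \<alpha> u (Suc (Suc t)) =
     residual_iterate f x\<^sub>1 \<eta> \<alpha> u (Suc t) -
     \<eta> *\<^sub>R residual_estimate f \<alpha>
       (residual_iterate f x\<^sub>1 \<eta> \<alpha> u (Suc t)) (u (Suc t))
       (residual_iterate f x\<^sub>1 \<eta> \<alpha> u t) (u t)"

end

theory Submission
  imports Defs
begin

text \<open>
  Write \<open>d\<close> for the dimension, \<open>x\<^sub>*\<close> for the minimiser, \<open>g\<^sub>t\<close> for the residual feedback direction and
  \<open>\<Phi>\<close> for the sum of the expected gaps \<open>E (f x\<^sub>t - f x\<^sub>*)\<close>. The proof compares two estimates of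
  the sum of \<open>g\<^sub>t \<bullet> (x\<^sub>t - x\<^sub>*)\<close>.

  Lower estimate, in expectation. Given the past, \<open>u\<^sub>t\<close> is uniform on the sphere, and the subtracted
  old function value only contributes a multiple of the mean of \<open>u\<^sub>t\<close>, which is zero. The claim is that
  \<open>g\<^sub>t\<close> correlates with \<open>x\<^sub>t - x\<^sub>*\<close> at least as much as the gap \<open>f x\<^sub>t - f x\<^sub>*\<close>, up to
  \<open>L \<alpha>\<^sup>2 / 2\<close> (\<open>one_point_estimate_correlation\<close>). The usual route identifies the mean of
  \<open>g\<^sub>t\<close> with the gradient of the average of \<open>f\<close> over a ball, by the divergence theorem. Here a
  symmetrisation replaces it: reflecting \<open>u\<close> in the hyperplane orthogonal to \<open>x - x\<^sub>*\<close> turns the mean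
  into an average of differences of \<open>f\<close> over chords parallel to \<open>x - x\<^sub>*\<close>. A one-dimensional
  argument bounds each chord difference from below (\<open>chord_lower_bound\<close>), and only two facts about the
  sphere remain: a squared coordinate has mean \<open>1 / d\<close>, and odd functions have mean zero. Both
  follow from rotation invariance.

  Upper estimate, for every realisation. Expanding \<open>\<parallel>x\<^sub>t\<^sub>+\<^sub>1 - x\<^sub>*\<parallel>\<^sup>2\<close> bounds the sum by
  \<open>\<parallel>x\<^sub>1 - x\<^sub>*\<parallel>\<^sup>2 / (2 \<eta>)\<close> plus \<open>\<eta> / 2\<close> times the sum of \<open>\<parallel>g\<^sub>t\<parallel>\<^sup>2\<close>. For a smooth function
  that is bounded below, \<open>\<parallel>\<nabla>f x\<parallel>\<^sup>2\<close> is at most \<open>2 L\<close> times the gap at \<open>x\<close>, so the two function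
  values in \<open>g\<^sub>t\<close> cost a multiple of the gaps at \<open>x\<^sub>t\<close> and \<open>x\<^sub>t\<^sub>-\<^sub>1\<close>. The remaining difference
  \<open>f x\<^sub>t - f x\<^sub>t\<^sub>-\<^sub>1\<close> is controlled by the Lipschitz condition and \<open>\<parallel>x\<^sub>t - x\<^sub>t\<^sub>-\<^sub>1\<parallel> = \<eta> \<parallel>g\<^sub>t\<^sub>-\<^sub>1\<parallel>\<close>; with
  \<open>\<eta> = \<alpha> / (4 d L\<^sub>0)\<close> this makes \<open>\<parallel>g\<^sub>t\<parallel>\<^sup>2\<close> a contracting recursion, which sums up
  (\<open>pathwise_regret_bound\<close>).

  Together, the gaps appear on both sides. The condition \<open>\<alpha> d L \<le> L\<^sub>0 / 16\<close>, which is what the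
  first lower bound on the number of iterations \<open>T\<close> says, keeps their coefficient on the right at most \<open>3 / 8\<close>, so
  they can be absorbed. The choice of \<open>\<alpha>\<close> balances \<open>\<parallel>x\<^sub>1 - x\<^sub>*\<parallel>\<^sup>2 / (2 \<eta>)\<close> with \<open>L \<alpha>\<^sup>2 T\<close> and
  gives \<open>\<Phi> \<le> 5 L \<alpha>\<^sup>2 T\<close> (\<open>expected_regret_le\<close>); the lower bound on \<open>T\<close> of order \<open>\<epsilon>\<close> to the
  power \<open>-3/2\<close> says that \<open>10 L \<alpha>\<^sup>2 \<le> \<epsilon>\<close>.
\<close>

section \<open>Smooth convex functions\<close>

locale smooth_convex =
  fixes f :: "'a::euclidean_space \<Rightarrow> real" and G :: "'a \<Rightarrow> 'a" and L :: real
  assumes gradient: "GDERIV f x :> G x"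
    and gradient_lipschitz: "L-lipschitz_on UNIV G"
    and convex: "convex_on UNIV f"
    and L_pos: "L > 0"
begin

lemma continuous: "continuous_on UNIV f"
  using gradient has_derivative_continuous
  unfolding gderiv_def continuous_on_eq_continuous_within by blast

lemma has_derivative_along_line:
  "((\<lambda>t. f (x + t *\<^sub>R v)) has_real_derivative (v \<bullet> G (x + t *\<^sub>R v))) (at t)"
proof -
  have "((\<lambda>t. x + t *\<^sub>R v) has_derivative (\<lambda>h. h *\<^sub>R v)) (at t)"
    by (auto intro!: derivative_eq_intros)
  from has_derivative_compose[OF this gradient[of "x + t *\<^sub>R v", unfolded gderiv_def]]
  show ?thesis
    by (simp add: has_field_derivative_def mult_commute_abs)
qed

lemma above_tangent: "f x + v \<bullet> G x \<le> f (x + v)"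
proof -
  have "convex_on UNIV (\<lambda>t::real. f (x + t *\<^sub>R v))"
  proof (rule convex_onI)
    fix t s r :: real
    assume t: "0 < t" "t < 1"
    have "x + ((1 - t) *\<^sub>R s + t *\<^sub>R r) *\<^sub>R v = (1 - t) *\<^sub>R (x + s *\<^sub>R v) + t *\<^sub>R (x + r *\<^sub>R v)"
      by (simp add: algebra_simps)
    then show "f (x + ((1 - t) *\<^sub>R s + t *\<^sub>R r) *\<^sub>R v)
        \<le> (1 - t) * f (x + s *\<^sub>R v) + t * f (x + r *\<^sub>R v)"
      using convex_onD[OF convex, of t "x + s *\<^sub>R v" "x + r *\<^sub>R v"] t by simp
  qed simp
  from convex_on_imp_above_tangent[OF this, of 0 1 "v \<bullet> G x"] has_derivative_along_line[of x v 0]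
  show ?thesis by simp
qed

lemma descent: "f (x + v) \<le> f x + v \<bullet> G x + L * (norm v)\<^sup>2 / 2"
proof -
  define \<phi> where "\<phi> t = f (x + t *\<^sub>R v) - t * (v \<bullet> G x) - L * t\<^sup>2 * (norm v)\<^sup>2 / 2" for t
  have "\<phi> 1 \<le> \<phi> 0"
  proof (rule DERIV_nonpos_imp_nonincreasing[of 0 1])
    fix t :: real
    assume t: "0 \<le> t" "t \<le> 1"
    have "v \<bullet> (G (x + t *\<^sub>R v) - G x) \<le> norm v * (L * (t * norm v))"
      using norm_cauchy_schwarz[of v "G (x + t *\<^sub>R v) - G x"] t
        lipschitz_onD[OF gradient_lipschitz, of "x + t *\<^sub>R v" x]
      by (fastforce simp: dist_norm intro: order_trans mult_left_mono)
    then have "v \<bullet> G (x + t *\<^sub>R v) - v \<bullet> G x - L * t * (norm v)\<^sup>2 \<le> 0"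
      by (simp add: inner_diff_right power2_eq_square algebra_simps)
    moreover have "(\<phi> has_real_derivative v \<bullet> G (x + t *\<^sub>R v) - v \<bullet> G x - L * t * (norm v)\<^sup>2) (at t)"
      unfolding \<phi>_def by (auto intro!: derivative_eq_intros has_derivative_along_line)
    ultimately show "\<exists>y. (\<phi> has_real_derivative y) (at t) \<and> y \<le> 0" by blast
  qed simp
  then show ?thesis by (simp add: \<phi>_def)
qed

text \<open>
  One gradient step of length \<open>1 / L\<close> decreases \<open>f\<close> by at least \<open>\<parallel>\<nabla>f x\<parallel>\<^sup>2 / (2 L)\<close>, but not below the
  minimum. This is what allows the size of the search directions to be paid for by the gaps.
\<close>

lemma norm_gradient_le:
  assumes "\<And>y. f xs \<le> f y"
  shows "(norm (G x))\<^sup>2 \<le> 2 * L * (f x - f xs)"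
proof -
  have "f xs \<le> f x + (- (1 / L) *\<^sub>R G x) \<bullet> G x + L * (norm (- (1 / L) *\<^sub>R G x))\<^sup>2 / 2"
    by (rule order_trans[OF assms descent])
  also have "\<dots> = f x - (norm (G x))\<^sup>2 / (2 * L)"
    using L_pos by (simp add: power_mult_distrib dot_square_norm field_simps power2_eq_square)
  finally show ?thesis
    using L_pos by (simp add: field_simps)
qed

text \<open>
  Along a line, the slope over the symmetric chord \<open>[-q, q]\<close> dominates the slope over \<open>[-s, 0]\<close>. For
  \<open>q \<le> s\<close> this is pure convexity, since slopes of chords increase with their endpoints. For \<open>q > s\<close> the
  symmetric chord reaches further back than \<open>[-s, 0]\<close>, and smoothness limits the loss: both slopes are
  compared with the derivative at the midpoint \<open>y\<close>. In either case the error is quadratic in \<open>q\<close> and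
  does not depend on \<open>s\<close>, so the distance to the minimiser never enters the bias.
\<close>

lemma chord_lower_bound:
  assumes e: "norm e = 1" and q: "q \<ge> 0" and s: "s \<ge> 0"
  shows "2 * q * (f y - f (y - s *\<^sub>R e) - L * q\<^sup>2 / 2) \<le> (f (y + q *\<^sub>R e) - f (y - q *\<^sub>R e)) * s"
proof (cases "q \<le> s")
  case True
  show ?thesis
  proof (cases "q = 0")
    case False
    with q True have pos: "0 < q" "0 < s" by auto
    \<comment> \<open>the slope over the symmetric chord is at least the slope over \<open>[-q, 0]\<close>\<close>
    have "y = (1 - 1/2) *\<^sub>R (y + q *\<^sub>R e) + (1/2) *\<^sub>R (y - q *\<^sub>R e)"
      by (simp add: algebra_simps flip: scaleR_add_left)
    then have mid: "2 * f y \<le> f (y + q *\<^sub>R e) + f (y - q *\<^sub>R e)"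
      using convex_onD[OF convex, of "1/2" "y + q *\<^sub>R e" "y - q *\<^sub>R e"] by simp
    \<comment> \<open>the slope over \<open>[-q, 0]\<close> is at least the slope over \<open>[-s, 0]\<close>\<close>
    have "y - q *\<^sub>R e = (1 - q / s) *\<^sub>R y + (q / s) *\<^sub>R (y - s *\<^sub>R e)"
      using pos by (simp add: algebra_simps)
    then have "f (y - q *\<^sub>R e) \<le> (1 - q / s) * f y + (q / s) * f (y - s *\<^sub>R e)"
      using convex_onD[OF convex, of "q / s" y "y - s *\<^sub>R e"] pos True by simp
    then have "q * (f y - f (y - s *\<^sub>R e)) \<le> s * (f y - f (y - q *\<^sub>R e))"
      using pos by (simp add: field_simps)
    moreover have "s * (2 * f y) \<le> s * (f (y + q *\<^sub>R e) + f (y - q *\<^sub>R e))"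
      using mid pos by (intro mult_left_mono) auto
    moreover have "0 \<le> q * (L * q\<^sup>2)"
      using pos L_pos by simp
    ultimately show ?thesis
      by (simp add: algebra_simps)
  qed simp
next
  case False
  have up: "f y + q * (e \<bullet> G y) \<le> f (y + q *\<^sub>R e)"
    using above_tangent[of y "q *\<^sub>R e"] by simp
  have down: "f (y - q *\<^sub>R e) \<le> f y - q * (e \<bullet> G y) + L * q\<^sup>2 / 2"
    using descent[of y "- q *\<^sub>R e"] e by simp
  have tangent: "f y - s * (e \<bullet> G y) \<le> f (y - s *\<^sub>R e)"
    using above_tangent[of y "- s *\<^sub>R e"] by simp
  have "2 * q * (f y - f (y - s *\<^sub>R e) - L * q\<^sup>2 / 2) \<le> 2 * q * (s * (e \<bullet> G y) - L * q\<^sup>2 / 2)"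
    using tangent q by (intro mult_left_mono) auto
  also have "\<dots> \<le> (2 * q * (e \<bullet> G y) - L * q\<^sup>2 / 2) * s"
  proof -
    have "(L * q\<^sup>2) * s \<le> (L * q\<^sup>2) * q"
      using False L_pos by (intro mult_left_mono) auto
    moreover have "0 \<le> (L * q\<^sup>2) * q"
      using q L_pos by simp
    ultimately show ?thesis by (simp add: algebra_simps)
  qed
  also have "\<dots> \<le> (f (y + q *\<^sub>R e) - f (y - q *\<^sub>R e)) * s"
    using up down s by (intro mult_right_mono) auto
  finally show ?thesis .
qed

lemma chord_lower_bound_signed:
  assumes e: "norm e = 1" and s: "s \<ge> 0"
  shows "2 * q\<^sup>2 * (f y - f (y - s *\<^sub>R e) - L * q\<^sup>2 / 2) \<le> (f (y + q *\<^sub>R e) - f (y - q *\<^sub>R e)) * (q * s)"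
proof (cases "q \<ge> 0")
  case True
  from mult_left_mono[OF chord_lower_bound[OF e True s] True] show ?thesis
    by (simp add: power2_eq_square algebra_simps)
next
  case False
  then have "- q \<ge> 0" by simp
  from mult_left_mono[OF chord_lower_bound[OF e this s] this] show ?thesis
    by (simp add: power2_eq_square algebra_simps)
qed

end

section \<open>Rotation invariance and moments of the uniform law on the sphere\<close>

text \<open>
  The rotation invariance of \<open>uniform_sphere\<close> rests on a change of variables that decomposes linear
  maps along an order of the coordinates. A finite index type need not come with an order; this copy of
  it is ordered by an enumeration, and relabelling the coordinates carries the invariance over.
\<close>

typedef 'a reordered = "UNIV :: 'a set" by simp

instance reordered :: (finite) finite
proof
  have "(UNIV :: 'a reordered set) = range Abs_reordered"
    by (metis UNIV_eq_I Rep_reordered_inverse rangeI)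
  then show "finite (UNIV :: 'a reordered set)"
    by (metis finite finite_imageI)
qed

instantiation reordered :: (finite) wellorder
begin

definition less_eq_reordered :: "'a reordered \<Rightarrow> 'a reordered \<Rightarrow> bool" where
  "x \<le> y \<longleftrightarrow> to_nat (Rep_reordered x) \<le> to_nat (Rep_reordered y)"

definition less_reordered :: "'a reordered \<Rightarrow> 'a reordered \<Rightarrow> bool" where
  "x < y \<longleftrightarrow> to_nat (Rep_reordered x) < to_nat (Rep_reordered y)"

instance
proof
  fix P :: "'a reordered \<Rightarrow> bool" and a
  assume "\<And>x. (\<And>y. y < x \<Longrightarrow> P y) \<Longrightarrow> P x"
  then show "P a"
    using wf_induct_rule[OF wf_measure[of "\<lambda>x. to_nat (Rep_reordered x)"], of P a]
    unfolding in_measure less_reordered_def by blast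
qed (auto simp: less_eq_reordered_def less_reordered_def Rep_reordered_inject)

end

text \<open>
  The preimage of a box under a relabelling of coordinates is the box with relabelled sides, which has the
  same volume; boxes determine Lebesgue measure.
\<close>

lemma distr_lborel_Basis_bijection:
  fixes g :: "'a::euclidean_space \<Rightarrow> 'b::euclidean_space"
  assumes g: "g \<in> borel_measurable borel"
    and basis: "bij_betw h Basis Basis"
    and inner: "\<And>x b. b \<in> Basis \<Longrightarrow> g x \<bullet> b = x \<bullet> h b"
  shows "distr lborel borel g = lborel"
proof (rule lborel_eqI[symmetric])
  fix l u :: 'b
  assume le: "\<And>b. b \<in> Basis \<Longrightarrow> l \<bullet> b \<le> u \<bullet> b"
  let ?k = "inv_into Basis h"
  define l' u' :: 'a where "l' = (\<Sum>b\<in>Basis. (l \<bullet> ?k b) *\<^sub>R b)" and "u' = (\<Sum>b\<in>Basis. (u \<bullet> ?k b) *\<^sub>R b)"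
  have k: "?k b \<in> Basis" "h (?k b) = b" if "b \<in> Basis" for b
    using that basis by (auto simp: bij_betw_def inv_into_into f_inv_into_f)
  have l': "l' \<bullet> b = l \<bullet> ?k b" "u' \<bullet> b = u \<bullet> ?k b" if "b \<in> Basis" for b
    using that by (auto simp: l'_def u'_def)
  have h: "h c \<in> Basis" "?k (h c) = c" if "c \<in> Basis" for c
    using that basis by (auto simp: bij_betw_def)
  have "g -` box l u = box l' u'"
  proof (intro set_eqI iffI)
    fix x assume "x \<in> g -` box l u"
    then have x: "l \<bullet> b < x \<bullet> h b \<and> x \<bullet> h b < u \<bullet> b" if "b \<in> Basis" for b
      using that by (auto simp: mem_box inner)
    show "x \<in> box l' u'"
      using x[OF k(1)] k(2) by (simp add: mem_box l')
  next
    fix x assume x: "x \<in> box l' u'"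
    have "l \<bullet> b < g x \<bullet> b \<and> g x \<bullet> b < u \<bullet> b" if "b \<in> Basis" for b
      using x h[OF that] that by (force simp: mem_box l' inner)
    then show "x \<in> g -` box l u"
      by (simp add: mem_box)
  qed
  then have "emeasure (distr lborel borel g) (box l u) = emeasure lborel (box l' u')"
    using g by (simp add: emeasure_distr)
  also have "\<dots> = (\<Prod>b\<in>Basis. (u' - l') \<bullet> b)"
    using le k by (intro emeasure_lborel_box) (auto simp: l')
  also have "(\<Prod>b\<in>Basis. (u' - l') \<bullet> b) = (\<Prod>b\<in>Basis. (u - l) \<bullet> ?k b)"
    by (intro prod.cong) (auto simp: l' inner_diff_left)
  also have "\<dots> = (\<Prod>b\<in>Basis. (u - l) \<bullet> b)"
    using bij_betw_inv_into[OF basis] by (rule prod.reindex_bij_betw)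
  finally show "emeasure (distr lborel borel g) (box l u) = (\<Prod>b\<in>Basis. (u - l) \<bullet> b)" .
qed simp

lemma sets_uniform_sphere [measurable_cong, simp]: "sets uniform_sphere = sets borel"
  by (simp add: uniform_sphere_def)

lemma space_uniform_sphere [simp]: "space uniform_sphere = UNIV"
  by (simp add: uniform_sphere_def)

lemma distr_uniform_sphere_isometry:
  fixes g :: "'a::euclidean_space \<Rightarrow> 'b::euclidean_space"
  assumes lin: "linear g" and iso: "\<And>x. norm (g x) = norm x"
    and lborel: "distr lborel borel g = lborel"
  shows "distr uniform_sphere borel g = uniform_sphere"
proof (rule measure_eqI)
  have g [measurable]: "g \<in> borel_measurable borel"
    using lin by (intro borel_measurable_continuous_onI linear_continuous_on)
      (simp add: linear_conv_bounded_linear)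
  have vim: "emeasure lborel (g -` S) = emeasure lborel S" if "S \<in> sets borel" for S
    using that by (subst lborel[symmetric]) (simp add: emeasure_distr)
  have ball: "g -` ball 0 1 = ball 0 1"
    by (auto simp: iso)
  fix A :: "'b set"
  assume "A \<in> sets (distr uniform_sphere borel g)"
  then have A [measurable]: "A \<in> sets borel" by simp
  have "ball 0 1 \<inter> {x. g (x /\<^sub>R norm x) \<in> A} = g -` (ball 0 1 \<inter> {y. y /\<^sub>R norm y \<in> A})"
    using lin by (auto simp: iso linear_scale)
  moreover have "ball 0 1 \<inter> {y::'b. y /\<^sub>R norm y \<in> A} \<in> sets borel"
    by measurable
  ultimately have eq: "emeasure lborel (ball 0 1 \<inter> {x. g (x /\<^sub>R norm x) \<in> A})
      = emeasure lborel (ball 0 1 \<inter> {y. y /\<^sub>R norm y \<in> A})"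
    using vim by metis
  have ball': "emeasure lborel (ball (0::'a) 1) = emeasure lborel (ball (0::'b) 1)"
    using vim[of "ball 0 1"] ball by simp
  have "emeasure (distr uniform_sphere borel g) A =
      emeasure lborel (ball 0 1 \<inter> {x. g (x /\<^sub>R norm x) \<in> A}) / emeasure lborel (ball (0 :: 'a) 1)"
    unfolding uniform_sphere_def by (simp add: distr_distr emeasure_distr vimage_def)
  also have "\<dots> = emeasure uniform_sphere A"
    unfolding eq ball' by (simp add: uniform_sphere_def emeasure_distr vimage_def)
  finally show "emeasure (distr uniform_sphere borel g) A = emeasure uniform_sphere A" .
qed (simp add: uniform_sphere_def)

text \<open>
  Conjugating \<open>R\<close> with the relabelling of coordinates gives an orthogonal map of the reordered space.
\<close>

lemma uniform_sphere_orthogonal_invariant: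
  fixes R :: "real ^ 'n \<Rightarrow> real ^ 'n"
  assumes R: "orthogonal_transformation R"
  shows "distr uniform_sphere borel R = uniform_sphere"
proof -
  define to :: "real ^ 'n \<Rightarrow> real ^ ('n reordered)" where "to x = (\<chi> i. x $ Rep_reordered i)" for x
  define from' :: "real ^ ('n reordered) \<Rightarrow> real ^ 'n" where "from' x = (\<chi> i. x $ Abs_reordered i)" for x
  have inverse [simp]: "to (from' y) = y" "from' (to x) = x" for x y
    by (auto simp: to_def from'_def vec_eq_iff Rep_reordered_inverse Abs_reordered_inverse)
  have lin: "linear to" "linear from'"
    by (auto intro!: linearI simp: to_def from'_def vec_eq_iff)
  have bijs: "bij (Rep_reordered :: 'n reordered \<Rightarrow> 'n)"
    by (metis bijI' Rep_reordered_inject Abs_reordered_inverse UNIV_I)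
  have iso_to: "norm (to x) = norm x" for x
    unfolding norm_vec_def L2_set_def to_def
    using sum.reindex_bij_betw[OF bijs, of "\<lambda>i. (norm (x $ i))\<^sup>2"] by simp
  have iso: "norm (from' y) = norm y" for y
    by (metis inverse(1) iso_to)
  have [measurable]: "to \<in> borel_measurable borel" "from' \<in> borel_measurable borel" "R \<in> borel_measurable borel"
    using lin R by (auto intro!: borel_measurable_continuous_onI linear_continuous_on
        simp: linear_conv_bounded_linear[symmetric] orthogonal_transformation_linear)
  have basis: "bij_betw (to \<circ> id) Basis Basis"
  proof (rule bij_betwI[where g = from'])
    have "to (axis i 1) = axis (Abs_reordered i) 1" for i
      by (auto simp: to_def axis_def vec_eq_iff Abs_reordered_inverse Rep_reordered_inverse)
    then show "to \<circ> id \<in> Basis \<rightarrow> Basis"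
      by (auto simp: Basis_vec_def)
    have "from' (axis i 1) = axis (Rep_reordered i) 1" for i
      by (auto simp: from'_def axis_def vec_eq_iff Abs_reordered_inverse Rep_reordered_inverse)
    then show "from' \<in> Basis \<rightarrow> Basis"
      by (auto simp: Basis_vec_def)
  qed auto
  have inner: "from' x \<bullet> b = x \<bullet> to b" for x b
    unfolding inner_vec_def from'_def to_def
    using sum.reindex_bij_betw[OF bijs, of "\<lambda>i. x $ Abs_reordered i \<bullet> b $ i"]
    by (simp add: Rep_reordered_inverse)
  have from_us: "distr uniform_sphere borel from' = uniform_sphere"
    by (intro distr_uniform_sphere_isometry lin iso
        distr_lborel_Basis_bijection[where h = "to \<circ> id"] basis) (auto simp: inner)
  define R' where "R' = to \<circ> R \<circ> from'"
  have "orthogonal_transformation R'"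
    using R lin iso iso_to unfolding R'_def orthogonal_transformation
    by (auto intro!: linear_compose)
  then have R': "distr uniform_sphere borel R' = uniform_sphere"
    by (rule uniform_sphere_orthogonal)
  have [measurable]: "R' \<in> borel_measurable borel"
    unfolding R'_def by measurable
  have "distr uniform_sphere borel R = distr (distr uniform_sphere borel from') borel R"
    by (simp add: from_us)
  also have "\<dots> = distr uniform_sphere borel (from' \<circ> R')"
    by (simp add: distr_distr R'_def comp_def)
  also have "\<dots> = distr (distr uniform_sphere borel R') borel from'"
    by (simp add: distr_distr)
  also have "\<dots> = uniform_sphere"
    by (simp add: R' from_us)
  finally show ?thesis .
qed

lemma integrable_uniform_sphere:
  fixes h :: "'a::euclidean_space \<Rightarrow> 'b::euclidean_space"
  assumes h: "continuous_on UNIV h"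
  shows "integrable uniform_sphere h"
proof -
  interpret prob_space "uniform_sphere :: 'a measure"
    by (rule prob_space_uniform_sphere)
  have "bounded (h ` sphere 0 1)"
    by (intro compact_imp_bounded compact_continuous_image continuous_on_subset[OF h]) auto
  then obtain B where B: "\<And>u. norm u = 1 \<Longrightarrow> norm (h u) \<le> B"
    unfolding bounded_iff by fastforce
  have "AE u in uniform_sphere. norm (h u) \<le> B"
    using AE_uniform_sphere by eventually_elim (rule B)
  moreover have "h \<in> borel_measurable uniform_sphere"
    using borel_measurable_continuous_onI[OF h] by simp
  ultimately show ?thesis
    by (intro integrable_const_bound)
qed

lemma integral_uniform_sphere_orthogonal:
  fixes h :: "real ^ 'n \<Rightarrow> 'b::euclidean_space" and R :: "real ^ 'n \<Rightarrow> real ^ 'n"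
  assumes R: "orthogonal_transformation R" and h: "h \<in> borel_measurable borel"
  shows "(\<integral>u. h (R u) \<partial>uniform_sphere) = (\<integral>u. h u \<partial>uniform_sphere)"
proof -
  have [measurable]: "R \<in> borel_measurable borel"
    using R by (intro borel_measurable_continuous_onI linear_continuous_on)
      (simp add: linear_conv_bounded_linear[symmetric] orthogonal_transformation_linear)
  have "(\<integral>u. h u \<partial>distr uniform_sphere borel R) = (\<integral>u. h (R u) \<partial>uniform_sphere)"
    using h by (intro integral_distr) measurable
  then show ?thesis
    by (simp add: uniform_sphere_orthogonal_invariant[OF R])
qed

lemma integral_uniform_sphere_odd:
  fixes h :: "real ^ 'n \<Rightarrow> real"
  assumes h: "h \<in> borel_measurable borel" and odd: "\<And>u. h (- u) = - h u"
  shows "(\<integral>u. h u \<partial>uniform_sphere) = 0"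
proof -
  have "orthogonal_transformation (uminus :: real ^ 'n \<Rightarrow> _)"
    by (auto simp: orthogonal_transformation_def intro!: linearI)
  from integral_uniform_sphere_orthogonal[OF this h] show ?thesis
    by (simp add: odd)
qed

text \<open>
  All unit vectors are related by rotations, so the second moment is the same in every direction; the
  second moments along a basis add up to the mean of \<open>\<parallel>u\<parallel>\<^sup>2\<close>, which is one.
\<close>

lemma integral_uniform_sphere_inner_power2:
  fixes e :: "real ^ 'n"
  assumes e: "norm e = 1"
  shows "(\<integral>u. (u \<bullet> e)\<^sup>2 \<partial>uniform_sphere) = 1 / real CARD('n)"
proof -
  let ?m = "\<lambda>b :: real ^ 'n. \<integral>u. (u \<bullet> b)\<^sup>2 \<partial>uniform_sphere"
  have int: "integrable uniform_sphere (\<lambda>u. (u \<bullet> b)\<^sup>2)" for b :: "real ^ 'n"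
    by (intro integrable_uniform_sphere continuous_intros)
  have same: "?m b = ?m e" if b: "b \<in> Basis" for b
  proof -
    obtain R :: "real ^ 'n \<Rightarrow> real ^ 'n" where R: "orthogonal_transformation R" "R b = e"
      using b e orthogonal_transformation_exists[of b e] by auto
    have "?m e = (\<integral>u. (R u \<bullet> e)\<^sup>2 \<partial>uniform_sphere)"
      by (intro integral_uniform_sphere_orthogonal[OF R(1), symmetric]
          borel_measurable_continuous_onI continuous_intros)
    also have "(\<lambda>u. (R u \<bullet> e)\<^sup>2) = (\<lambda>u. (u \<bullet> b)\<^sup>2)"
      using R by (auto simp: orthogonal_transformation_def)
    finally show ?thesis by simp
  qed
  have "1 = (\<integral>u. (\<Sum>b\<in>Basis. (u \<bullet> b)\<^sup>2) \<partial>(uniform_sphere :: (real ^ 'n) measure))"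
  proof -
    have "AE u in uniform_sphere. (\<Sum>b\<in>Basis. ((u :: real ^ 'n) \<bullet> b)\<^sup>2) = 1"
      using AE_uniform_sphere
    proof eventually_elim
      case (elim u)
      then show ?case
        using euclidean_inner[of u u] by (simp add: power2_eq_square norm_eq_1)
    qed
    then have "(\<integral>u. (\<Sum>b\<in>Basis. ((u :: real ^ 'n) \<bullet> b)\<^sup>2) \<partial>uniform_sphere) = (\<integral>u. 1 \<partial>(uniform_sphere :: (real ^ 'n) measure))"
      by (intro integral_cong_AE borel_measurable_integrable integrable_uniform_sphere continuous_intros)
    then show ?thesis
      using prob_space.prob_space[OF prob_space_uniform_sphere[where 'a = "real ^ 'n"]] by simp
  qed
  also have "\<dots> = (\<Sum>b\<in>(Basis :: (real ^ 'n) set). ?m b)"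
    using int by (intro Bochner_Integration.integral_sum)
  also have "\<dots> = real CARD('n) * ?m e"
    using same by simp
  finally show ?thesis
    by (simp add: field_simps)
qed

section \<open>The one-point estimate against the distance to a minimiser\<close>

lemma orthogonal_transformation_reflection:
  fixes e :: "'a::real_inner"
  assumes e: "norm e = 1"
  shows "orthogonal_transformation (\<lambda>u. u - (2 * (u \<bullet> e)) *\<^sub>R e)"
proof -
  have "e \<bullet> e = 1" using e by (simp add: norm_eq_1)
  then show ?thesis
    unfolding orthogonal_transformation_def
    by (auto intro!: linearI simp: algebra_simps inner_commute)
qed

text \<open>
  Here \<open>e\<close> is the direction from the minimiser to \<open>x\<close>, and \<open>u\<close> is paired with its reflection in the
  hyperplane orthogonal to \<open>e\<close>. The points \<open>x + \<alpha> u\<close> and \<open>x + \<alpha> u'\<close> span a chord parallel to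
  \<open>e\<close> with midpoint \<open>x + \<alpha> z\<close>, where \<open>z\<close> is the part of \<open>u\<close> orthogonal to \<open>e\<close>. The chord is
  compared with the segment from \<open>x\<^sub>* + \<alpha> z\<close> to \<open>x + \<alpha> z\<close>, and then \<open>z\<close> is removed at both ends by
  the tangent at \<open>x\<close> and smoothness at \<open>x\<^sub>*\<close>. The two errors are \<open>L \<alpha>\<^sup>2 (u \<bullet> e)\<^sup>2 / 2\<close> and
  \<open>L \<alpha>\<^sup>2 \<parallel>z\<parallel>\<^sup>2 / 2\<close>, which add up to \<open>L \<alpha>\<^sup>2 / 2\<close> because \<open>\<parallel>u\<parallel> = 1\<close>. The linear term in
  \<open>z\<close> is kept for the integration over \<open>u\<close>.
\<close>

lemma (in smooth_convex) one_point_estimate_correlation_pointwise: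
  assumes min: "\<And>y. f xs \<le> f y" and \<alpha>: "\<alpha> > 0" and e: "norm e = 1" and s: "s \<ge> 0"
    and x: "x = xs + s *\<^sub>R e" and u: "norm u = 1"
  shows "2 * (u \<bullet> e)\<^sup>2 * (f x - f xs - L * \<alpha>\<^sup>2 / 2 + \<alpha> * ((u - (u \<bullet> e) *\<^sub>R e) \<bullet> G x))
    \<le> (f (x + \<alpha> *\<^sub>R u) - f (x + \<alpha> *\<^sub>R (u - (2 * (u \<bullet> e)) *\<^sub>R e))) / \<alpha> * (s * (u \<bullet> e))"
proof -
  define p where "p = u \<bullet> e"
  define z where "z = u - p *\<^sub>R e"
  define y where "y = x + \<alpha> *\<^sub>R z"
  have ee: "e \<bullet> e = 1" and uu: "u \<bullet> u = 1" using e u by (simp_all add: norm_eq_1)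
  have zz: "(norm z)\<^sup>2 = 1 - p\<^sup>2"
    unfolding power2_norm_eq_inner z_def
    by (simp add: ee uu inner_diff_left inner_diff_right inner_commute p_def power2_eq_square)
  have pts: "x + \<alpha> *\<^sub>R u = y + (\<alpha> * p) *\<^sub>R e" "x + \<alpha> *\<^sub>R (u - (2 * p) *\<^sub>R e) = y - (\<alpha> * p) *\<^sub>R e"
    "y - s *\<^sub>R e = xs + \<alpha> *\<^sub>R z"
    by (simp_all add: y_def z_def x algebra_simps flip: scaleR_add_left)
  have G0: "G xs = 0"
    using norm_gradient_le[OF min, of xs] by simp
  have lower: "f x + \<alpha> * (z \<bullet> G x) \<le> f y"
    using above_tangent[of x "\<alpha> *\<^sub>R z"] by (simp add: y_def)
  have upper: "f (xs + \<alpha> *\<^sub>R z) \<le> f xs + L * \<alpha>\<^sup>2 * (1 - p\<^sup>2) / 2"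
    using descent[of xs "\<alpha> *\<^sub>R z"] \<alpha> by (simp add: G0 power_mult_distrib zz algebra_simps)
  have "\<alpha>\<^sup>2 * (2 * p\<^sup>2 * (f x - f xs - L * \<alpha>\<^sup>2 / 2 + \<alpha> * (z \<bullet> G x)))
      = 2 * (\<alpha> * p)\<^sup>2 * (f x + \<alpha> * (z \<bullet> G x) - (f xs + L * \<alpha>\<^sup>2 * (1 - p\<^sup>2) / 2) - L * (\<alpha> * p)\<^sup>2 / 2)"
    by (simp add: power_mult_distrib field_simps)
  also have "\<dots> \<le> 2 * (\<alpha> * p)\<^sup>2 * (f y - f (y - s *\<^sub>R e) - L * (\<alpha> * p)\<^sup>2 / 2)"
    using lower upper unfolding pts by (intro mult_left_mono) auto
  also have "\<dots> \<le> (f (x + \<alpha> *\<^sub>R u) - f (x + \<alpha> *\<^sub>R (u - (2 * p) *\<^sub>R e))) * (\<alpha> * p * s)"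
    using chord_lower_bound_signed[OF e s, of "\<alpha> * p" y] unfolding pts by (simp only: mult.assoc)
  also have "\<dots> = \<alpha>\<^sup>2 * ((f (x + \<alpha> *\<^sub>R u) - f (x + \<alpha> *\<^sub>R (u - (2 * p) *\<^sub>R e))) / \<alpha> * (s * p))"
    using \<alpha> by (simp add: field_simps power2_eq_square)
  finally show ?thesis
    using \<alpha> unfolding z_def p_def by (simp only: mult_le_cancel_left_pos zero_less_power)
qed

text \<open>
  Averaging the integrand with its composition with the reflection removes the baseline \<open>c\<close> and allows
  the pointwise bound to be applied. Its weight \<open>(u \<bullet> e)\<^sup>2\<close> has mean \<open>1 / d\<close>, which cancels the
  factor \<open>d\<close> of the estimator, and its linear term is odd in \<open>u\<close> and has mean zero.
\<close>

lemma one_point_estimate_correlation: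
  fixes f :: "real ^ 'n \<Rightarrow> real"
  assumes sc: "smooth_convex f G L" and min: "\<And>y. f xs \<le> f y" and \<alpha>: "\<alpha> > 0"
  shows "f x - f xs - L * \<alpha>\<^sup>2 / 2
    \<le> (\<integral>u. ((real CARD('n) * ((f (x + \<alpha> *\<^sub>R u) - c) / \<alpha>)) *\<^sub>R u) \<bullet> (x - xs) \<partial>uniform_sphere)"
proof (cases "x = xs")
  case True
  interpret smooth_convex f G L by (rule sc)
  show ?thesis using True L_pos by simp
next
  case False
  interpret smooth_convex f G L by (rule sc)
  let ?d = "real CARD('n)"
  define s where "s = norm (x - xs)"
  define e where "e = (x - xs) /\<^sub>R s"
  define R where "R u = u - (2 * (u \<bullet> e)) *\<^sub>R e" for u
  define h where "h u = ((?d * ((f (x + \<alpha> *\<^sub>R u) - c) / \<alpha>)) *\<^sub>R u) \<bullet> (x - xs)" for u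
  define A where "A = f x - f xs - L * \<alpha>\<^sup>2 / 2"
  define B where "B u = (u \<bullet> e)\<^sup>2 * (\<alpha> * ((u - (u \<bullet> e) *\<^sub>R e) \<bullet> G x))" for u
  have s: "s > 0" using False by (simp add: s_def)
  have e: "norm e = 1" using s by (simp add: e_def s_def)
  have xs: "x - xs = s *\<^sub>R e" using s by (simp add: e_def)
  have R: "orthogonal_transformation R"
    unfolding R_def using e by (rule orthogonal_transformation_reflection)
  have Re: "R u \<bullet> e = - (u \<bullet> e)" for u
    using e by (simp add: R_def inner_diff_left norm_eq_1)
  have cont_f: "continuous_on UNIV (\<lambda>u. f (x + \<alpha> *\<^sub>R g u))" if "continuous_on UNIV g" for g :: "real ^ 'n \<Rightarrow> _"
    by (rule continuous_on_compose2[OF continuous]) (auto intro!: continuous_intros that)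
  have cont_R: "continuous_on UNIV R"
    unfolding R_def by (intro continuous_intros)
  have cont: "continuous_on UNIV h"
    unfolding h_def using \<alpha> by (intro continuous_intros cont_f) auto
  have cont': "continuous_on UNIV (\<lambda>u. h (R u))"
    by (rule continuous_on_compose2[OF cont cont_R]) auto
  have cont_B: "continuous_on UNIV B"
    unfolding B_def by (intro continuous_intros)
  have pointwise: "2 * ?d * ((u \<bullet> e)\<^sup>2 * A + B u) \<le> h u + h (R u)" if "norm u = 1" for u
  proof -
    have "2 * (u \<bullet> e)\<^sup>2 * (A + \<alpha> * ((u - (u \<bullet> e) *\<^sub>R e) \<bullet> G x))
        \<le> (f (x + \<alpha> *\<^sub>R u) - f (x + \<alpha> *\<^sub>R R u)) / \<alpha> * (s * (u \<bullet> e))"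
      unfolding A_def R_def using xs that s
      by (intro one_point_estimate_correlation_pointwise[OF min \<alpha> e]) (auto simp: algebra_simps)
    from mult_left_mono[OF this, of ?d] show ?thesis
      using \<alpha> unfolding h_def xs by (simp add: Re B_def field_simps)
  qed
  have "(\<integral>u. B u \<partial>uniform_sphere) = 0"
    by (intro integral_uniform_sphere_odd borel_measurable_continuous_onI[OF cont_B])
      (simp add: B_def inner_diff_left algebra_simps)
  then have "2 * A = (\<integral>u. 2 * ?d * ((u \<bullet> e)\<^sup>2 * A + B u) \<partial>uniform_sphere)"
    using integral_uniform_sphere_inner_power2[OF e]
    by (simp add: Bochner_Integration.integral_add integrable_uniform_sphere cont_B continuous_intros)
  also have "\<dots> \<le> (\<integral>u. h u + h (R u) \<partial>uniform_sphere)"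
  proof (rule integral_mono_AE)
    show "AE u in uniform_sphere. 2 * ?d * ((u \<bullet> e)\<^sup>2 * A + B u) \<le> h u + h (R u)"
      using AE_uniform_sphere by eventually_elim (rule pointwise)
  qed (auto intro!: integrable_uniform_sphere continuous_intros cont cont' cont_B)
  also have "\<dots> = (\<integral>u. h u \<partial>uniform_sphere) + (\<integral>u. h (R u) \<partial>uniform_sphere)"
    by (intro Bochner_Integration.integral_add integrable_uniform_sphere cont cont')
  also have "(\<integral>u. h (R u) \<partial>uniform_sphere) = (\<integral>u. h u \<partial>uniform_sphere)"
    by (intro integral_uniform_sphere_orthogonal R borel_measurable_continuous_onI cont)
  finally show ?thesis
    by (simp add: A_def h_def)
qed

section \<open>Pathwise energy estimate\<close>

context smooth_convex
begin

text \<open>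
  By convexity and smoothness the increment is \<open>\<alpha> u \<bullet> \<nabla>f x\<close> up to an error in the interval from \<open>0\<close>
  to \<open>L \<alpha>\<^sup>2 / 2\<close>, and the gradient is bounded by the gap.
\<close>

lemma increment_squared_le:
  assumes min: "\<And>y. f xs \<le> f y" and u: "norm u = 1"
  shows "(f (x + \<alpha> *\<^sub>R u) - f x)\<^sup>2 \<le> \<alpha>\<^sup>2 * (4 * L * (f x - f xs) + L\<^sup>2 * \<alpha>\<^sup>2 / 2)"
proof -
  define p where "p = (\<alpha> *\<^sub>R u) \<bullet> G x"
  define r where "r = f (x + \<alpha> *\<^sub>R u) - f x - p"
  have r: "0 \<le> r" "r \<le> L * \<alpha>\<^sup>2 / 2"
    using above_tangent[of x "\<alpha> *\<^sub>R u"] descent[of x "\<alpha> *\<^sub>R u"] u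
    by (auto simp: r_def p_def power_mult_distrib)
  have "p\<^sup>2 \<le> (norm (\<alpha> *\<^sub>R u) * norm (G x))\<^sup>2"
    unfolding p_def using Cauchy_Schwarz_ineq2[of "\<alpha> *\<^sub>R u" "G x"] by (intro abs_le_square_iff[THEN iffD1]) simp
  also have "\<dots> = \<alpha>\<^sup>2 * (norm (G x))\<^sup>2"
    using u by (simp add: power_mult_distrib)
  also have "\<dots> \<le> \<alpha>\<^sup>2 * (2 * L * (f x - f xs))"
    by (intro mult_left_mono norm_gradient_le min) simp
  finally have p: "p\<^sup>2 \<le> \<alpha>\<^sup>2 * (2 * L * (f x - f xs))" .
  have r2: "r\<^sup>2 \<le> (L * \<alpha>\<^sup>2 / 2)\<^sup>2"
    using r by (intro power_mono)
  have "(f (x + \<alpha> *\<^sub>R u) - f x)\<^sup>2 = (p + r)\<^sup>2"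
    by (simp add: r_def)
  also have "\<dots> \<le> 2 * p\<^sup>2 + 2 * r\<^sup>2"
    using sum_squares_ge_zero[of "p - r" 0] by (simp add: power2_eq_square algebra_simps)
  also have "\<dots> \<le> 2 * (\<alpha>\<^sup>2 * (2 * L * (f x - f xs))) + 2 * (L * \<alpha>\<^sup>2 / 2)\<^sup>2"
    using p r2 by linarith
  also have "\<dots> = \<alpha>\<^sup>2 * (4 * L * (f x - f xs) + L\<^sup>2 * \<alpha>\<^sup>2 / 2)"
    by (simp add: power2_eq_square field_simps)
  finally show ?thesis .
qed

text \<open>
  The difference of the two function values splits into the increment of the new query at \<open>x\<close>, the
  increment of the old query at \<open>x'\<close>, and \<open>f x - f x'\<close>.
\<close>

lemma residual_estimate_squared_le:
  fixes x x' u u' xs :: 'a and \<alpha> L\<^sub>0 :: real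
  defines "b \<equiv> \<lambda>x. (real DIM('a))\<^sup>2 * (4 * L * (f x - f xs) + L\<^sup>2 * \<alpha>\<^sup>2 / 2)"
  assumes min: "\<And>y. f xs \<le> f y" and lipschitz: "L\<^sub>0-lipschitz_on UNIV f" and \<alpha>: "\<alpha> > 0"
    and u: "norm u = 1" "norm u' = 1"
  shows "(norm (residual_estimate f \<alpha> x u x' u'))\<^sup>2
    \<le> 3 * b x + 3 * b x' + 3 * (real DIM('a) * L\<^sub>0 / \<alpha> * norm (x - x'))\<^sup>2"
proof -
  let ?d = "real DIM('a)"
  define p where "p = f (x + \<alpha> *\<^sub>R u) - f x"
  define p' where "p' = f (x' + \<alpha> *\<^sub>R u') - f x'"
  define q where "q = f x - f x'"
  have "q\<^sup>2 \<le> (L\<^sub>0 * norm (x - x'))\<^sup>2"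
    using lipschitz_onD[OF lipschitz, of x x'] unfolding q_def
    by (intro abs_le_square_iff[THEN iffD1]) (simp add: dist_norm)
  then have q: "(?d / \<alpha>)\<^sup>2 * q\<^sup>2 \<le> (?d / \<alpha>)\<^sup>2 * (L\<^sub>0 * norm (x - x'))\<^sup>2"
    by (intro mult_left_mono) auto
  have p: "(?d / \<alpha>)\<^sup>2 * p\<^sup>2 \<le> b x"
    using mult_left_mono[OF increment_squared_le[OF min u(1), of x \<alpha>], of "(?d / \<alpha>)\<^sup>2"] \<alpha>
    unfolding p_def b_def by (simp add: power_divide)
  have p': "(?d / \<alpha>)\<^sup>2 * p'\<^sup>2 \<le> b x'"
    using mult_left_mono[OF increment_squared_le[OF min u(2), of x' \<alpha>], of "(?d / \<alpha>)\<^sup>2"] \<alpha>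
    unfolding p'_def b_def by (simp add: power_divide)
  have "(norm (residual_estimate f \<alpha> x u x' u'))\<^sup>2 = (?d / \<alpha>)\<^sup>2 * (p - p' + q)\<^sup>2"
    using u by (simp add: residual_estimate_def p_def p'_def q_def power_mult_distrib power_divide)
  also have "\<dots> \<le> (?d / \<alpha>)\<^sup>2 * (3 * p\<^sup>2 + 3 * p'\<^sup>2 + 3 * q\<^sup>2)"
  proof (rule mult_left_mono)
    have "0 \<le> (p + p')\<^sup>2 + (p - q)\<^sup>2 + (p' + q)\<^sup>2" by simp
    then show "(p - p' + q)\<^sup>2 \<le> 3 * p\<^sup>2 + 3 * p'\<^sup>2 + 3 * q\<^sup>2"
      by (simp add: power2_eq_square algebra_simps)
  qed simp
  also have "\<dots> \<le> 3 * b x + 3 * b x' + 3 * ((?d / \<alpha>)\<^sup>2 * (L\<^sub>0 * norm (x - x'))\<^sup>2)"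
    using p p' q unfolding distrib_left by linarith
  also have "(?d / \<alpha>)\<^sup>2 * (L\<^sub>0 * norm (x - x'))\<^sup>2 = (?d * L\<^sub>0 / \<alpha> * norm (x - x'))\<^sup>2"
    by (simp add: power_mult_distrib power_divide)
  finally show ?thesis .
qed

end

text \<open>
  A potential argument: the partial sums of \<open>a\<close>, together with \<open>1/4\<close> of the last \<open>a\<close> and \<open>15/4\<close> of the
  last \<open>b\<close>, stay below twelve times the partial sums of \<open>b\<close>. The reserve in \<open>a\<close> pays for the term
  \<open>3 / 16 * a k\<close> of the next step (\<open>5/4 * 3/16 \<le> 1/4\<close>), and the reserve in \<open>b\<close> for the term \<open>3 * b k\<close>
  (\<open>5/4 * 3 = 15/4\<close>).
\<close>

lemma sum_contracting_recursion_le: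
  fixes a b :: "nat \<Rightarrow> real"
  assumes start: "a 0 \<le> 6 * b 0"
    and step: "\<And>k. Suc k < n \<Longrightarrow> a (Suc k) \<le> 3 * b (Suc k) + 3 * b k + 3 / 16 * a k"
    and a: "\<And>k. a k \<ge> 0" and b: "\<And>k. b k \<ge> 0"
  shows "(\<Sum>k<n. a k) \<le> 12 * (\<Sum>k<n. b k)"
proof -
  have potential: "(\<Sum>k<Suc m. a k) + a m / 4 + 15 / 4 * b m \<le> 12 * (\<Sum>k<Suc m. b k)" if "m < n" for m
    using that
  proof (induction m)
    case 0
    then show ?case using start b[of 0] by simp
  next
    case (Suc m)
    with step[of m] a[of m] b[of m] b[of "Suc m"] show ?case by simp
  qed
  show ?thesis
  proof (cases n)
    case (Suc m)
    with potential[of m] a[of m] b[of m] show ?thesis by simp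
  qed simp
qed

text \<open>
  The \<open>k\<close>-th direction moves iterate \<open>k + 1\<close> to iterate \<open>k + 2\<close>, because iterates \<open>0\<close> and
  \<open>1\<close> coincide. Counting directions from zero makes the past of direction \<open>k\<close> the random vectors
  \<open>u 0, \<dots>, u k\<close>.
\<close>

definition residual_direction ::
  "('a::euclidean_space \<Rightarrow> real) \<Rightarrow> 'a \<Rightarrow> real \<Rightarrow> real \<Rightarrow> (nat \<Rightarrow> 'a) \<Rightarrow> nat \<Rightarrow> 'a" where
  "residual_direction f x\<^sub>1 \<eta> \<alpha> u k = residual_estimate f \<alpha>
     (residual_iterate f x\<^sub>1 \<eta> \<alpha> u (Suc k)) (u (Suc k)) (residual_iterate f x\<^sub>1 \<eta> \<alpha> u k) (u k)"

lemma residual_iterate_Suc_Suc: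
  "residual_iterate f x\<^sub>1 \<eta> \<alpha> u (Suc (Suc k)) =
    residual_iterate f x\<^sub>1 \<eta> \<alpha> u (Suc k) - \<eta> *\<^sub>R residual_direction f x\<^sub>1 \<eta> \<alpha> u k"
  by (simp add: residual_direction_def)

text \<open>
  The squared distance to \<open>xs\<close> telescopes, and its final value is nonnegative.
\<close>

lemma sum_inner_directions_le:
  fixes f :: "'a::euclidean_space \<Rightarrow> real" and x\<^sub>1 xs :: 'a and u :: "nat \<Rightarrow> 'a" and \<eta> \<alpha> :: real
  assumes \<eta>: "\<eta> > 0"
  defines "g \<equiv> residual_direction f x\<^sub>1 \<eta> \<alpha> u" and "x \<equiv> \<lambda>k. residual_iterate f x\<^sub>1 \<eta> \<alpha> u (Suc k)"
  shows "(\<Sum>k<n. g k \<bullet> (x k - xs)) \<le> (norm (x\<^sub>1 - xs))\<^sup>2 / (2 * \<eta>) + \<eta> / 2 * (\<Sum>k<n. (norm (g k))\<^sup>2)"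
proof -
  have square: "(norm (v - \<eta> *\<^sub>R w))\<^sup>2 = (norm v)\<^sup>2 - 2 * \<eta> * (w \<bullet> v) + \<eta>\<^sup>2 * (norm w)\<^sup>2" for v w :: 'a
    unfolding power2_norm_eq_inner
    by (simp add: inner_diff_left inner_diff_right inner_commute power2_eq_square)
  have "(norm (x n - xs))\<^sup>2 = (norm (x\<^sub>1 - xs))\<^sup>2
      - 2 * \<eta> * (\<Sum>k<n. g k \<bullet> (x k - xs)) + \<eta>\<^sup>2 * (\<Sum>k<n. (norm (g k))\<^sup>2)"
  proof (induction n)
    case 0
    then show ?case by (simp add: x_def)
  next
    case (Suc n)
    have "x (Suc n) - xs = (x n - xs) - \<eta> *\<^sub>R g n"
      by (simp add: x_def g_def residual_iterate_Suc_Suc del: residual_iterate.simps)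
    then have "(norm (x (Suc n) - xs))\<^sup>2 =
        (norm (x n - xs))\<^sup>2 - 2 * \<eta> * (g n \<bullet> (x n - xs)) + \<eta>\<^sup>2 * (norm (g n))\<^sup>2"
      by (simp only: square)
    with Suc show ?case by (simp add: distrib_left)
  qed
  moreover have "0 \<le> (norm (x n - xs))\<^sup>2" by simp
  ultimately have "2 * \<eta> * (\<Sum>k<n. g k \<bullet> (x k - xs))
      \<le> (norm (x\<^sub>1 - xs))\<^sup>2 + \<eta>\<^sup>2 * (\<Sum>k<n. (norm (g k))\<^sup>2)"
    by linarith
  then show ?thesis
    using \<eta> by (simp add: field_simps power2_eq_square)
qed

text \<open>
  The step size is chosen such that the movement of the iterates feeds back one sixteenth of the previous
  squared direction, times three; so the squared directions obey the contracting recursion above. At the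
  first step both queries are made around the same point, which gives the starting value.
\<close>

lemma (in smooth_convex) pathwise_regret_bound:
  fixes x\<^sub>1 xs :: 'a and u :: "nat \<Rightarrow> 'a" and \<eta> \<alpha> L\<^sub>0 :: real
  defines "d \<equiv> real DIM('a)"
  assumes min: "\<And>y. f xs \<le> f y" and lipschitz: "L\<^sub>0-lipschitz_on UNIV f" and L0: "L\<^sub>0 > 0"
    and \<alpha>: "\<alpha> > 0" and \<eta>: "\<eta> = \<alpha> / (4 * d * L\<^sub>0)"
    and u: "\<And>k. k \<le> n \<Longrightarrow> norm (u k) = 1"
  defines "g \<equiv> residual_direction f x\<^sub>1 \<eta> \<alpha> u" and "x \<equiv> \<lambda>k. residual_iterate f x\<^sub>1 \<eta> \<alpha> u (Suc k)"
  shows "(\<Sum>k<n. g k \<bullet> (x k - xs)) \<le> (norm (x\<^sub>1 - xs))\<^sup>2 / (2 * \<eta>)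
    + 6 * \<eta> * d\<^sup>2 * (\<Sum>k<n. 4 * L * (f (x k) - f xs) + L\<^sup>2 * \<alpha>\<^sup>2 / 2)"
proof (cases "n = 0")
  case False
  define b where "b x = d\<^sup>2 * (4 * L * (f x - f xs) + L\<^sup>2 * \<alpha>\<^sup>2 / 2)" for x
  have d: "d > 0" by (simp add: d_def)
  have \<eta>_pos: "\<eta> > 0" using \<alpha> L0 d \<eta> by simp
  note bound = residual_estimate_squared_le[OF min lipschitz \<alpha>, folded d_def, folded b_def]
  have "(\<Sum>k<n. (norm (g k))\<^sup>2) \<le> 12 * (\<Sum>k<n. b (x k))"
  proof (rule sum_contracting_recursion_le)
    show "(norm (g 0))\<^sup>2 \<le> 6 * b (x 0)"
      using bound[of "u (Suc 0)" "u 0" x\<^sub>1 x\<^sub>1] False u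
      by (simp add: g_def x_def residual_direction_def)
  next
    fix k assume k: "Suc k < n"
    have "x (Suc k) - x k = - \<eta> *\<^sub>R g k"
      by (simp add: x_def g_def residual_iterate_Suc_Suc del: residual_iterate.simps)
    then have "(d * L\<^sub>0 / \<alpha> * norm (x (Suc k) - x k))\<^sup>2 = (norm (g k))\<^sup>2 / 16"
      using d L0 \<alpha> \<eta> by (simp add: power_mult_distrib power_divide)
    moreover have "(norm (g (Suc k)))\<^sup>2
        \<le> 3 * b (x (Suc k)) + 3 * b (x k) + 3 * (d * L\<^sub>0 / \<alpha> * norm (x (Suc k) - x k))\<^sup>2"
      unfolding g_def x_def residual_direction_def using k by (intro bound u) auto
    ultimately show "(norm (g (Suc k)))\<^sup>2 \<le> 3 * b (x (Suc k)) + 3 * b (x k) + 3 / 16 * (norm (g k))\<^sup>2"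
      by simp
  next
    show "0 \<le> b (x k)" for k
      unfolding b_def using min[of "x k"] L_pos by (intro mult_nonneg_nonneg add_nonneg_nonneg) auto
  qed simp
  then have "\<eta> / 2 * (\<Sum>k<n. (norm (g k))\<^sup>2) \<le> \<eta> / 2 * (12 * (\<Sum>k<n. b (x k)))"
    using \<eta>_pos by (intro mult_left_mono) auto
  moreover have "(\<Sum>k<n. b (x k)) = d\<^sup>2 * (\<Sum>k<n. 4 * L * (f (x k) - f xs) + L\<^sup>2 * \<alpha>\<^sup>2 / 2)"
    by (simp only: b_def sum_distrib_left)
  ultimately show ?thesis
    using sum_inner_directions_le[OF \<eta>_pos, of f x\<^sub>1 \<alpha> u xs n] unfolding g_def x_def by (simp add: mult.assoc)
qed (simp add: \<eta> \<alpha> L0 d_def less_imp_le)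

section \<open>Dependence of the iterates on the random directions\<close>

lemma residual_iterate_cong:
  assumes "\<And>s. s < t \<Longrightarrow> v s = w s"
  shows "residual_iterate f x\<^sub>1 \<eta> \<alpha> v t = residual_iterate f x\<^sub>1 \<eta> \<alpha> w t"
  using assms by (induction f x\<^sub>1 \<eta> \<alpha> v t rule: residual_iterate.induct) auto

text \<open>
  Needed for integrability only: as \<open>f\<close> is Lipschitz, one step from bounded iterates leads to bounded
  iterates, uniformly in the directions on the sphere.
\<close>

lemma residual_iterate_bounded:
  fixes f :: "'a::euclidean_space \<Rightarrow> real"
  assumes lipschitz: "L\<^sub>0-lipschitz_on UNIV f"
  shows "\<exists>C. \<forall>u. (\<forall>s\<le>k. norm (u s) = 1) \<longrightarrow>
    norm (residual_iterate f x\<^sub>1 \<eta> \<alpha> u k) \<le> C \<and> norm (residual_iterate f x\<^sub>1 \<eta> \<alpha> u (Suc k)) \<le> C"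
proof (induction k)
  case 0
  then show ?case by (intro exI[of _ "norm x\<^sub>1"]) simp
next
  case (Suc k)
  let ?x = "residual_iterate f x\<^sub>1 \<eta> \<alpha>"
  from Suc obtain C where C: "\<And>u. (\<forall>s\<le>k. norm (u s) = 1) \<Longrightarrow> norm (?x u k) \<le> C \<and> norm (?x u (Suc k)) \<le> C"
    by auto
  define K where "K = real DIM('a) * (L\<^sub>0 * (2 * C + 2 * \<bar>\<alpha>\<bar>) / \<bar>\<alpha>\<bar>)"
  have K: "norm (residual_direction f x\<^sub>1 \<eta> \<alpha> u k) \<le> K" if u: "\<forall>s\<le>Suc k. norm (u s) = 1" for u
  proof -
    have "dist (?x u (Suc k) + \<alpha> *\<^sub>R u (Suc k)) (?x u k + \<alpha> *\<^sub>R u k) \<le> 2 * C + 2 * \<bar>\<alpha>\<bar>"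
    proof -
      have "dist (?x u (Suc k) + \<alpha> *\<^sub>R u (Suc k)) (?x u k + \<alpha> *\<^sub>R u k)
          \<le> (norm (?x u (Suc k)) + norm (\<alpha> *\<^sub>R u (Suc k))) + (norm (?x u k) + norm (\<alpha> *\<^sub>R u k))"
        unfolding dist_norm by (intro norm_triangle_le_diff add_mono norm_triangle_ineq)
      also have "\<dots> \<le> (C + \<bar>\<alpha>\<bar>) + (C + \<bar>\<alpha>\<bar>)"
        using C[of u] u by (intro add_mono) auto
      finally show ?thesis by simp
    qed
    then have "\<bar>f (?x u (Suc k) + \<alpha> *\<^sub>R u (Suc k)) - f (?x u k + \<alpha> *\<^sub>R u k)\<bar> \<le> L\<^sub>0 * (2 * C + 2 * \<bar>\<alpha>\<bar>)"
      using lipschitz_onD[OF lipschitz, of "?x u (Suc k) + \<alpha> *\<^sub>R u (Suc k)" "?x u k + \<alpha> *\<^sub>R u k"]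
        lipschitz_on_nonneg[OF lipschitz]
      by (auto simp: dist_real_def intro: order_trans mult_left_mono)
    then show ?thesis
      using u unfolding residual_direction_def residual_estimate_def K_def
      by (auto simp: abs_mult intro!: mult_left_mono divide_right_mono)
  qed
  have "norm (?x u (Suc (Suc k))) \<le> C + \<bar>\<eta>\<bar> * K \<and> norm (?x u (Suc k)) \<le> C + \<bar>\<eta>\<bar> * K"
    if u: "\<forall>s\<le>Suc k. norm (u s) = 1" for u
  proof -
    have "norm (?x u (Suc (Suc k))) \<le> norm (?x u (Suc k)) + \<bar>\<eta>\<bar> * norm (residual_direction f x\<^sub>1 \<eta> \<alpha> u k)"
      unfolding residual_iterate_Suc_Suc
      using norm_triangle_ineq4[of "?x u (Suc k)" "\<eta> *\<^sub>R residual_direction f x\<^sub>1 \<eta> \<alpha> u k"] by simp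
    moreover have "\<bar>\<eta>\<bar> * norm (residual_direction f x\<^sub>1 \<eta> \<alpha> u k) \<le> \<bar>\<eta>\<bar> * K"
      using K[OF u] by (rule mult_left_mono) simp
    moreover have "norm (?x u (Suc k)) \<le> C" using C[of u] u by simp
    moreover have "0 \<le> \<bar>\<eta>\<bar> * norm (residual_direction f x\<^sub>1 \<eta> \<alpha> u k)" by simp
    ultimately show ?thesis by linarith
  qed
  then show ?case by blast
qed

lemma residual_iterate_measurable:
  fixes f :: "'a::euclidean_space \<Rightarrow> real"
  assumes f: "f \<in> borel_measurable borel" and "{..<t} \<subseteq> I"
  shows "(\<lambda>v. residual_iterate f x\<^sub>1 \<eta> \<alpha> v t) \<in> borel_measurable (PiM I (\<lambda>_. borel))"
  using assms(2)
proof (induction t rule: less_induct)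
  case (less t)
  note [measurable] = f
  consider "t = 0" | "t = Suc 0" | k where "t = Suc (Suc k)"
    by (metis not0_implies_Suc)
  then show ?case
  proof cases
    case 3
    have [measurable]: "(\<lambda>v. residual_iterate f x\<^sub>1 \<eta> \<alpha> v (Suc k)) \<in> borel_measurable (PiM I (\<lambda>_. borel))"
      "(\<lambda>v. residual_iterate f x\<^sub>1 \<eta> \<alpha> v k) \<in> borel_measurable (PiM I (\<lambda>_. borel))"
      using less.prems 3 by (auto intro!: less.IH)
    have [measurable]: "(\<lambda>v. v (Suc k)) \<in> borel_measurable (PiM I (\<lambda>_. borel))"
      "(\<lambda>v. v k) \<in> borel_measurable (PiM I (\<lambda>_. borel))"
      using less.prems 3 by (auto intro!: measurable_component_singleton)
    show ?thesis
      unfolding 3 residual_iterate.simps residual_estimate_def by measurable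
  qed simp_all
qed

section \<open>Integration over an independent variable\<close>

text \<open>
  A substitute for conditioning: if \<open>Y\<close> is independent of \<open>X\<close>, a bound on the mean over \<open>Y\<close> alone that
  holds for every fixed value of \<open>X\<close> survives taking the expectation over both.
\<close>

lemma (in prob_space) expectation_mono_independent:
  fixes h :: "'b \<Rightarrow> real" and H :: "'b \<Rightarrow> 'b \<Rightarrow> real"
  assumes indep: "indep_var N X S Y"
    and h: "h \<in> borel_measurable N" and H: "case_prod H \<in> borel_measurable (N \<Otimes>\<^sub>M S)"
    and int_h: "integrable M (\<lambda>\<omega>. h (X \<omega>))" and int_H: "integrable M (\<lambda>\<omega>. H (X \<omega>) (Y \<omega>))"
    and le: "\<And>x. x \<in> space N \<Longrightarrow> h x \<le> expectation (\<lambda>\<omega>. H x (Y \<omega>))"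
  shows "expectation (\<lambda>\<omega>. h (X \<omega>)) \<le> expectation (\<lambda>\<omega>. H (X \<omega>) (Y \<omega>))"
proof -
  have X [measurable]: "X \<in> measurable M N" and Y [measurable]: "Y \<in> measurable M S"
    and joint: "distr M N X \<Otimes>\<^sub>M distr M S Y = distr M (N \<Otimes>\<^sub>M S) (\<lambda>\<omega>. (X \<omega>, Y \<omega>))"
    using indep by (auto simp: indep_var_distribution_eq)
  interpret X: prob_space "distr M N X" by (rule prob_space_distr) fact
  interpret Y: prob_space "distr M S Y" by (rule prob_space_distr) fact
  interpret XY: pair_prob_space "distr M N X" "distr M S Y" ..
  have int: "integrable (distr M N X \<Otimes>\<^sub>M distr M S Y) (case_prod H)"
    unfolding joint using H int_H by (subst integrable_distr_eq) auto
  have le': "h x \<le> (\<integral>y. H x y \<partial>distr M S Y)" if "x \<in> space N" for x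
    using le[OF that] that H by (subst integral_distr) auto
  have "expectation (\<lambda>\<omega>. h (X \<omega>)) = (\<integral>x. h x \<partial>distr M N X)"
    using h by (simp add: integral_distr)
  also have "\<dots> \<le> (\<integral>x. (\<integral>y. H x y \<partial>distr M S Y) \<partial>distr M N X)"
    using h int_h XY.integrable_fst'[OF int] le'
    by (intro integral_mono) (auto simp: integrable_distr_eq)
  also have "\<dots> = (\<integral>z. case_prod H z \<partial>(distr M N X \<Otimes>\<^sub>M distr M S Y))"
    using XY.integral_fst'[OF int] by simp
  also have "\<dots> = expectation (\<lambda>\<omega>. H (X \<omega>) (Y \<omega>))"
    unfolding joint using H by (subst integral_distr) auto
  finally show ?thesis .
qed

lemma (in prob_space) integrable_continuous_AE_bounded:
  fixes Z :: "'a \<Rightarrow> 'b::euclidean_space" and h :: "'b \<Rightarrow> real"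
  assumes Z: "Z \<in> borel_measurable M" and C: "AE \<omega> in M. norm (Z \<omega>) \<le> C" and h: "continuous_on UNIV h"
  shows "integrable M (\<lambda>\<omega>. h (Z \<omega>))"
proof -
  have "bounded (h ` cball 0 C)"
    by (intro compact_imp_bounded compact_continuous_image continuous_on_subset[OF h]) auto
  then obtain B where B: "\<And>z. norm z \<le> C \<Longrightarrow> norm (h z) \<le> B"
    unfolding bounded_iff by fastforce
  have "AE \<omega> in M. norm (h (Z \<omega>)) \<le> B"
    using C by eventually_elim (rule B)
  moreover have "(\<lambda>\<omega>. h (Z \<omega>)) \<in> borel_measurable M"
    using borel_measurable_continuous_onI[OF h] Z by measurable
  ultimately show ?thesis by (intro integrable_const_bound)
qed

section \<open>Expected suboptimality of the iterates\<close>

locale residual_feedback = prob_space M + smooth_convex f G L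
  for M :: "'w measure" and f :: "real ^ 'n \<Rightarrow> real" and G L +
  fixes L\<^sub>0 \<alpha> \<eta> :: real and x\<^sub>1 xs :: "real ^ 'n" and u :: "nat \<Rightarrow> 'w \<Rightarrow> real ^ 'n" and n :: nat
  assumes lipschitz: "L\<^sub>0-lipschitz_on UNIV f" and L0_pos: "L\<^sub>0 > 0" and \<alpha>_pos: "\<alpha> > 0"
    and \<eta>: "\<eta> = \<alpha> / (4 * real CARD('n) * L\<^sub>0)"
    and minimizer: "f xs \<le> f y"
    and indep: "indep_vars (\<lambda>_. borel) u {0..n}"
    and uniform: "t \<le> n \<Longrightarrow> distr M borel (u t) = uniform_sphere"
begin

abbreviation iterate :: "nat \<Rightarrow> 'w \<Rightarrow> real ^ 'n" where
  "iterate t \<omega> \<equiv> residual_iterate f x\<^sub>1 \<eta> \<alpha> (\<lambda>s. u s \<omega>) t"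

abbreviation direction :: "nat \<Rightarrow> 'w \<Rightarrow> real ^ 'n" where
  "direction k \<omega> \<equiv> residual_direction f x\<^sub>1 \<eta> \<alpha> (\<lambda>s. u s \<omega>) k"

lemma f_measurable [measurable]: "f \<in> borel_measurable borel"
  by (rule borel_measurable_continuous_onI[OF continuous])

lemma u_measurable: "t \<le> n \<Longrightarrow> u t \<in> borel_measurable M"
  using indep by (auto simp: indep_vars_def)

lemma AE_unit: "AE \<omega> in M. \<forall>t\<le>n. norm (u t \<omega>) = 1"
proof -
  have "AE \<omega> in M. norm (u t \<omega>) = 1" if "t \<le> n" for t
    using AE_uniform_sphere[where 'a = "real ^ 'n"] u_measurable[OF that]
    unfolding uniform[OF that, symmetric] by (subst (asm) AE_distr_iff) auto
  then have "AE \<omega> in M. \<forall>t\<in>{..n}. norm (u t \<omega>) = 1"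
    by (intro AE_finite_allI) auto
  then show ?thesis by eventually_elim auto
qed

text \<open>
  Up to index \<open>k + 1\<close> the iterates are functions of \<open>u 0, \<dots>, u k\<close>, hence independent of \<open>u (k + 1)\<close>.
\<close>

lemma iterate_eq_history:
  "t \<le> Suc k \<Longrightarrow> iterate t \<omega> = residual_iterate f x\<^sub>1 \<eta> \<alpha> (restrict (\<lambda>s. u s \<omega>) {..k}) t"
  by (intro residual_iterate_cong) auto

lemma history_measurable:
  "k \<le> n \<Longrightarrow> (\<lambda>\<omega>. restrict (\<lambda>s. u s \<omega>) {..k}) \<in> measurable M (PiM {..k} (\<lambda>_. borel))"
  by (intro measurable_restrict u_measurable) auto

lemma iterate_measurable: "t \<le> Suc n \<Longrightarrow> iterate t \<in> borel_measurable M"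
  using measurable_compose[OF history_measurable
      residual_iterate_measurable[OF f_measurable, of t "{..n}" x\<^sub>1 \<eta> \<alpha>]]
    iterate_eq_history[of t n]
  by (simp add: subset_eq)

lemma AE_bounded:
  assumes "k < n"
  shows "\<exists>C. AE \<omega> in M. norm (iterate (Suc k) \<omega>, u (Suc k) \<omega>, iterate k \<omega>, u k \<omega>) \<le> C"
proof -
  obtain C where C: "\<And>v. (\<forall>s\<le>k. norm (v s) = 1) \<Longrightarrow>
      norm (residual_iterate f x\<^sub>1 \<eta> \<alpha> v k) \<le> C \<and> norm (residual_iterate f x\<^sub>1 \<eta> \<alpha> v (Suc k)) \<le> C"
    using residual_iterate_bounded[OF lipschitz, of k x\<^sub>1 \<eta> \<alpha>] by auto
  have pair: "norm (a, b) \<le> norm a + norm b" for a :: "'c::real_normed_vector" and b :: "'d::real_normed_vector"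
    by (simp add: norm_Pair sqrt_sum_squares_le_sum)
  have "AE \<omega> in M. norm (iterate (Suc k) \<omega>, u (Suc k) \<omega>, iterate k \<omega>, u k \<omega>) \<le> 2 * C + 2"
    using AE_unit
  proof eventually_elim
    case (elim \<omega>)
    have "norm (iterate (Suc k) \<omega>, u (Suc k) \<omega>, iterate k \<omega>, u k \<omega>)
        \<le> norm (iterate (Suc k) \<omega>) + (norm (u (Suc k) \<omega>) + (norm (iterate k \<omega>) + norm (u k \<omega>)))"
      by (intro order_trans[OF pair] add_left_mono order_refl)
    also have "\<dots> \<le> C + (1 + (C + 1))"
      using elim assms C[of "\<lambda>s. u s \<omega>"] by (intro add_mono) auto
    finally show ?case by simp
  qed
  then show ?thesis by blast
qed

lemma integrable_state:
  assumes k: "k < n" and h: "continuous_on UNIV (\<lambda>(x, w, x', w'). h x w x' w')"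
  shows "integrable M (\<lambda>\<omega>. h (iterate (Suc k) \<omega>) (u (Suc k) \<omega>) (iterate k \<omega>) (u k \<omega>) :: real)"
proof -
  obtain C where C: "AE \<omega> in M. norm (iterate (Suc k) \<omega>, u (Suc k) \<omega>, iterate k \<omega>, u k \<omega>) \<le> C"
    using AE_bounded[OF k] by blast
  have "(\<lambda>\<omega>. (iterate (Suc k) \<omega>, u (Suc k) \<omega>, iterate k \<omega>, u k \<omega>)) \<in> borel_measurable M"
    using k by (intro borel_measurable_Pair iterate_measurable u_measurable) auto
  from integrable_continuous_AE_bounded[OF this C h] show ?thesis by simp
qed

lemma continuous_compose: "continuous_on UNIV (\<lambda>z. f (g z))" if "continuous_on UNIV g" for g :: "'c::topological_space \<Rightarrow> _"
  by (rule continuous_on_compose2[OF continuous that]) simp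

lemma integrable_f: "k < n \<Longrightarrow> integrable M (\<lambda>\<omega>. f (iterate (Suc k) \<omega>))"
  by (rule integrable_state[where h = "\<lambda>x w x' w'. f x"])
    (auto simp: case_prod_unfold intro!: continuous_compose continuous_intros)

lemma integrable_correlation:
  "k < n \<Longrightarrow> integrable M (\<lambda>\<omega>. direction k \<omega> \<bullet> (iterate (Suc k) \<omega> - xs))"
  unfolding residual_direction_def
  by (rule integrable_state[where h = "\<lambda>x w x' w'. residual_estimate f \<alpha> x w x' w' \<bullet> (x - xs)"])
    (use \<alpha>_pos in \<open>auto simp: case_prod_unfold residual_estimate_def intro!: continuous_compose continuous_intros\<close>)

text \<open>
  Given \<open>u 0, \<dots>, u k\<close>, everything in direction \<open>k\<close> except \<open>u (k + 1)\<close> is fixed, and the estimate for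
  a single uniform vector applies; the old function value takes the role of the baseline.
\<close>

lemma expected_correlation_ge:
  assumes k: "k < n"
  shows "expectation (\<lambda>\<omega>. f (iterate (Suc k) \<omega>) - f xs) - L * \<alpha>\<^sup>2 / 2
    \<le> expectation (\<lambda>\<omega>. direction k \<omega> \<bullet> (iterate (Suc k) \<omega> - xs))"
proof -
  let ?N = "\<lambda>A. PiM A (\<lambda>_. borel) :: (nat \<Rightarrow> real ^ 'n) measure"
  let ?X = "\<lambda>A \<omega>. restrict (\<lambda>s. u s \<omega>) A"
  define x where "x v t = residual_iterate f x\<^sub>1 \<eta> \<alpha> v t" for v t
  define H where "H v w = residual_estimate f \<alpha> (x v (Suc k)) (w (Suc k)) (x v k) (v k) \<bullet> (x v (Suc k) - xs)" for v w
  have ind: "indep_var (?N {..k}) (?X {..k}) (?N {Suc k}) (?X {Suc k})"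
    using k by (intro indep_var_restrict[OF indep]) auto
  have [measurable]: "(\<lambda>v. x v (Suc k)) \<in> borel_measurable (?N {..k})" "(\<lambda>v. x v k) \<in> borel_measurable (?N {..k})"
    unfolding x_def by (auto intro!: residual_iterate_measurable)
  have [measurable]: "(\<lambda>v. v k) \<in> borel_measurable (?N {..k})" "(\<lambda>v. v (Suc k)) \<in> borel_measurable (?N {Suc k})"
    by (auto intro!: measurable_component_singleton)
  have H_eq: "H (?X {..k} \<omega>) (?X {Suc k} \<omega>) = direction k \<omega> \<bullet> (iterate (Suc k) \<omega> - xs)" for \<omega>
    using iterate_eq_history[of "Suc k" k \<omega>] iterate_eq_history[of k k \<omega>]
    by (simp add: H_def x_def residual_direction_def)
  have f_eq: "f (x (?X {..k} \<omega>) (Suc k)) = f (iterate (Suc k) \<omega>)" for \<omega>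
    using iterate_eq_history[of "Suc k" k \<omega>] by (simp add: x_def)
  have "expectation (\<lambda>\<omega>. f (x (?X {..k} \<omega>) (Suc k)) - f xs - L * \<alpha>\<^sup>2 / 2)
      \<le> expectation (\<lambda>\<omega>. H (?X {..k} \<omega>) (?X {Suc k} \<omega>))"
  proof (rule expectation_mono_independent[OF ind])
    show "(\<lambda>v. f (x v (Suc k)) - f xs - L * \<alpha>\<^sup>2 / 2) \<in> borel_measurable (?N {..k})"
      by measurable
    show "case_prod H \<in> borel_measurable (?N {..k} \<Otimes>\<^sub>M ?N {Suc k})"
      unfolding H_def residual_estimate_def by measurable
    show "integrable M (\<lambda>\<omega>. f (x (?X {..k} \<omega>) (Suc k)) - f xs - L * \<alpha>\<^sup>2 / 2)"
      using integrable_f[OF k] by (simp only: f_eq) auto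
    show "integrable M (\<lambda>\<omega>. H (?X {..k} \<omega>) (?X {Suc k} \<omega>))"
      using integrable_correlation[OF k] by (simp only: H_eq)
  next
    fix v :: "nat \<Rightarrow> real ^ 'n"
    let ?h = "\<lambda>w. residual_estimate f \<alpha> (x v (Suc k)) w (x v k) (v k) \<bullet> (x v (Suc k) - xs)"
    have "f (x v (Suc k)) - f xs - L * \<alpha>\<^sup>2 / 2 \<le> (\<integral>w. ?h w \<partial>uniform_sphere)"
      using one_point_estimate_correlation[OF smooth_convex_axioms minimizer \<alpha>_pos]
      by (simp add: residual_estimate_def)
    also have "\<dots> = (\<integral>w. ?h w \<partial>distr M borel (u (Suc k)))"
      using k by (simp add: uniform)
    also have "\<dots> = expectation (\<lambda>\<omega>. ?h (u (Suc k) \<omega>))"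
      using k unfolding residual_estimate_def by (intro integral_distr u_measurable) (simp, measurable)
    finally show "f (x v (Suc k)) - f xs - L * \<alpha>\<^sup>2 / 2 \<le> expectation (\<lambda>\<omega>. H v (?X {Suc k} \<omega>))"
      by (simp add: H_def)
  qed
  then show ?thesis
    using integrable_f[OF k] by (simp add: H_eq f_eq prob_space)
qed

text \<open>
  The two estimates of the correlation sum combine to
  \<open>\<Phi> - V / 2 \<le> \<parallel>x\<^sub>1 - xs\<parallel>\<^sup>2 / (2 \<eta>) + 6 \<eta> d\<^sup>2 (4 L \<Phi> + L V / 2)\<close> with \<open>V = L \<alpha>\<^sup>2 n\<close>. The first
  term is at most \<open>2 V\<close> by the assumption \<open>radius\<close>, and by the assumption \<open>small\<close> the second is at
  most \<open>3/8 \<Phi> + 3/64 V\<close>; the gaps are absorbed on the left.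
\<close>

theorem expected_regret_le:
  assumes small: "\<alpha> * real CARD('n) * L \<le> L\<^sub>0 / 16"
    and radius: "(norm (x\<^sub>1 - xs))\<^sup>2 * real CARD('n) * L\<^sub>0 \<le> real n * L * \<alpha> ^ 3"
  shows "(\<Sum>k<n. expectation (\<lambda>\<omega>. f (iterate (Suc k) \<omega>) - f xs)) \<le> 5 * (L * \<alpha>\<^sup>2) * real n"
proof -
  let ?d = "real CARD('n)"
  define F where "F k = expectation (\<lambda>\<omega>. f (iterate (Suc k) \<omega>) - f xs)" for k
  define \<Phi> where "\<Phi> = (\<Sum>k<n. F k)"
  define R where "R = norm (x\<^sub>1 - xs)"
  define V where "V = L * \<alpha>\<^sup>2 * real n"
  have \<eta>_pos: "\<eta> > 0" using \<alpha>_pos L0_pos \<eta> by simp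
  have V: "V \<ge> 0" using L_pos by (simp add: V_def)
  have F_nonneg: "F k \<ge> 0" for k
    unfolding F_def using minimizer by (intro integral_nonneg_AE) simp
  then have \<Phi>: "\<Phi> \<ge> 0" unfolding \<Phi>_def by (intro sum_nonneg)
  have int: "integrable M (\<lambda>\<omega>. 4 * L * (f (iterate (Suc k) \<omega>) - f xs) + L\<^sup>2 * \<alpha>\<^sup>2 / 2)" if "k < n" for k
    using integrable_f[OF that] by auto
  have "\<Phi> - V / 2 = (\<Sum>k<n. F k - L * \<alpha>\<^sup>2 / 2)"
    by (simp add: \<Phi>_def V_def sum_subtractf)
  also have "\<dots> \<le> (\<Sum>k<n. expectation (\<lambda>\<omega>. direction k \<omega> \<bullet> (iterate (Suc k) \<omega> - xs)))"
    unfolding F_def by (intro sum_mono expected_correlation_ge) auto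
  also have "\<dots> = expectation (\<lambda>\<omega>. \<Sum>k<n. direction k \<omega> \<bullet> (iterate (Suc k) \<omega> - xs))"
    by (intro Bochner_Integration.integral_sum[symmetric] integrable_correlation) auto
  also have "\<dots> \<le> expectation (\<lambda>\<omega>. R\<^sup>2 / (2 * \<eta>)
      + 6 * \<eta> * ?d\<^sup>2 * (\<Sum>k<n. 4 * L * (f (iterate (Suc k) \<omega>) - f xs) + L\<^sup>2 * \<alpha>\<^sup>2 / 2))"
  proof (rule integral_mono_AE)
    show "AE \<omega> in M. (\<Sum>k<n. direction k \<omega> \<bullet> (iterate (Suc k) \<omega> - xs)) \<le> R\<^sup>2 / (2 * \<eta>)
      + 6 * \<eta> * ?d\<^sup>2 * (\<Sum>k<n. 4 * L * (f (iterate (Suc k) \<omega>) - f xs) + L\<^sup>2 * \<alpha>\<^sup>2 / 2)"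
      using AE_unit
    proof eventually_elim
      case (elim \<omega>)
      then show ?case
        using pathwise_regret_bound[OF minimizer lipschitz L0_pos \<alpha>_pos, of \<eta> n "\<lambda>s. u s \<omega>" x\<^sub>1] \<eta>
        by (simp add: R_def)
    qed
    show "integrable M (\<lambda>\<omega>. \<Sum>k<n. direction k \<omega> \<bullet> (iterate (Suc k) \<omega> - xs))"
      by (intro Bochner_Integration.integrable_sum integrable_correlation) auto
    show "integrable M (\<lambda>\<omega>. R\<^sup>2 / (2 * \<eta>)
      + 6 * \<eta> * ?d\<^sup>2 * (\<Sum>k<n. 4 * L * (f (iterate (Suc k) \<omega>) - f xs) + L\<^sup>2 * \<alpha>\<^sup>2 / 2))"
      by (intro Bochner_Integration.integrable_add integrable_const integrable_mult_right
          Bochner_Integration.integrable_sum int) auto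
  qed
  also have "\<dots> = R\<^sup>2 / (2 * \<eta>) + 6 * \<eta> * ?d\<^sup>2 * (\<Sum>k<n. 4 * L * F k + L\<^sup>2 * \<alpha>\<^sup>2 / 2)"
  proof -
    have "expectation (\<lambda>\<omega>. 4 * L * (f (iterate (Suc k) \<omega>) - f xs) + L\<^sup>2 * \<alpha>\<^sup>2 / 2)
        = 4 * L * F k + L\<^sup>2 * \<alpha>\<^sup>2 / 2" if "k < n" for k
      using integrable_f[OF that] by (simp add: F_def prob_space)
    then have "expectation (\<lambda>\<omega>. \<Sum>k<n. 4 * L * (f (iterate (Suc k) \<omega>) - f xs) + L\<^sup>2 * \<alpha>\<^sup>2 / 2)
        = (\<Sum>k<n. 4 * L * F k + L\<^sup>2 * \<alpha>\<^sup>2 / 2)"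
      using int by (subst Bochner_Integration.integral_sum) auto
    moreover have "integrable M (\<lambda>\<omega>. \<Sum>k<n. 4 * L * (f (iterate (Suc k) \<omega>) - f xs) + L\<^sup>2 * \<alpha>\<^sup>2 / 2)"
      by (intro Bochner_Integration.integrable_sum int) auto
    ultimately show ?thesis
      by (subst Bochner_Integration.integral_add) (auto simp: prob_space)
  qed
  also have "(\<Sum>k<n. 4 * L * F k + L\<^sup>2 * \<alpha>\<^sup>2 / 2) = 4 * L * \<Phi> + L * V / 2"
    by (simp add: \<Phi>_def V_def sum.distrib sum_distrib_left power2_eq_square)
  also have "6 * \<eta> * ?d\<^sup>2 * (4 * L * \<Phi> + L * V / 2) = \<alpha> * ?d * L / L\<^sub>0 * (6 * \<Phi> + 3 / 4 * V)"
    using L0_pos by (simp add: \<eta> power2_eq_square field_simps)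
  also have "\<dots> \<le> 1 / 16 * (6 * \<Phi> + 3 / 4 * V)"
    using small L0_pos \<Phi> V by (intro mult_right_mono) (auto simp: field_simps)
  also have "R\<^sup>2 / (2 * \<eta>) = 2 * (R\<^sup>2 * ?d * L\<^sub>0) / \<alpha>"
    using L0_pos \<alpha>_pos by (simp add: \<eta> field_simps)
  also have "\<dots> \<le> 2 * (real n * L * \<alpha> ^ 3) / \<alpha>"
    using radius \<alpha>_pos unfolding R_def by (intro divide_right_mono mult_left_mono) auto
  also have "2 * (real n * L * \<alpha> ^ 3) / \<alpha> = 2 * V"
    using \<alpha>_pos by (simp add: V_def power2_eq_square power3_eq_cube)
  finally have "\<Phi> - V / 2 \<le> 2 * V + 3 / 8 * \<Phi> + 3 / 64 * V"
    by (simp add: add_divide_distrib)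
  then have "\<Phi> \<le> 5 * V"
    using V by linarith
  then show ?thesis
    by (simp add: \<Phi>_def F_def V_def mult.assoc)
qed

end

section \<open>Calibration of the smoothing radius and the main result\<close>

lemma smoothing_radius_cubed:
  fixes R q :: real
  assumes "R > 0" "q > 0" and \<alpha>: "\<alpha> = R powr (2/3) * q powr (1/3)"
  shows "\<alpha> ^ 3 = R\<^sup>2 * q"
  using assms(1,2) unfolding \<alpha> by (simp add: power_mult_distrib powr_power)

text \<open>
  The assumption \<open>radius\<close> eliminates the initial distance from the bound on \<open>n\<close>; what is left is the
  conclusion raised to the power \<open>3/2\<close>.
\<close>

lemma accuracy_ge_of_iteration_number:
  fixes \<epsilon> L \<alpha> n D :: real
  assumes pos: "\<epsilon> > 0" "L > 0" "\<alpha> > 0" "n > 0"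
    and radius: "D = n * L * \<alpha> ^ 3"
    and n: "n \<ge> 10 powr (3/2) * D * L powr (1/2) / \<epsilon> powr (3/2)"
  shows "10 * (L * \<alpha>\<^sup>2) \<le> \<epsilon>"
proof -
  have "L powr (3/2) = L powr 1 * L powr (1/2)"
    unfolding powr_add[symmetric] by simp
  moreover have "(\<alpha>\<^sup>2) powr (3/2) = \<alpha> ^ 3"
    using pos by (simp add: powr_powr flip: powr_numeral)
  ultimately have "(10 * (L * \<alpha>\<^sup>2)) powr (3/2) = 10 powr (3/2) * (L powr 1 * L powr (1/2)) * \<alpha> ^ 3"
    using pos by (simp add: powr_mult)
  then have "(10 * (L * \<alpha>\<^sup>2)) powr (3/2) * n = 10 powr (3/2) * D * L powr (1/2)"
    using pos by (simp add: radius)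
  also have "\<dots> \<le> \<epsilon> powr (3/2) * n"
    using n pos by (simp add: field_simps)
  finally have "(10 * (L * \<alpha>\<^sup>2)) powr (3/2) \<le> \<epsilon> powr (3/2)"
    using pos by simp
  then show ?thesis
    using powr_less_mono2[of "3/2" \<epsilon> "10 * (L * \<alpha>\<^sup>2)"] pos by (meson less_le_not_le not_le order_less_imp_le zero_less_divide_iff zero_less_numeral)
qed

theorem corollary2:
  fixes f :: "real ^ 'n \<Rightarrow> real"
    and x\<^sub>1 xstar :: "real ^ 'n"
    and L\<^sub>0 L \<eta> \<alpha> \<epsilon> :: real
    and T :: nat
    and M :: "'w measure"
    and u :: "nat \<Rightarrow> 'w \<Rightarrow> real ^ 'n"
  assumes L0_pos: "L\<^sub>0 > 0"
    and L_pos: "L > 0"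
    and lipschitz: "L\<^sub>0-lipschitz_on UNIV f"
    and smooth: "smooth_fun L f"
    and convex: "convex_on UNIV f"
    and minimizer: "\<forall>y. f xstar \<le> f y"
    and prob: "prob_space M"
    and indep: "prob_space.indep_vars M (\<lambda>_. borel) u {0..T}"
    and uniform: "\<forall>t\<in>{0..T}. distr M borel (u t) = uniform_sphere"
    and T_pos: "T \<ge> 1"
    and alpha_pos: "\<alpha> > 0"
    and eta_pos: "\<eta> > 0"
    and eta: "\<eta> = \<alpha> / (4 * real CARD('n) * L\<^sub>0)"
    and alpha: "\<alpha> = norm (x\<^sub>1 - xstar) powr (2/3) * (real CARD('n) * L\<^sub>0 / (real T * L)) powr (1/3)"
    and eps_pos: "\<epsilon> > 0"
    and T_ge1: "real T \<ge> 2 ^ 12 * norm (x\<^sub>1 - xstar) ^ 2 * real CARD('n) ^ 4 * (L / L\<^sub>0) ^ 2"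
    and T_ge2: "real T \<ge> max
      (10 powr (3/2) * norm (x\<^sub>1 - xstar) ^ 2 * L\<^sub>0 * L powr (1/2) * (real CARD('n) / \<epsilon> powr (3/2)))
      (8 powr (3/4) * L\<^sub>0 * norm (x\<^sub>1 - xstar) powr (1/2) / L powr (1/4)
         * (real CARD('n) powr (1/4) / \<epsilon> powr (3/4)))"
  shows "1 / real T * (\<Sum>t = 1..T. \<integral>\<omega>. (f (residual_iterate f x\<^sub>1 \<eta> \<alpha> (\<lambda>s. u s \<omega>) t) - f xstar) \<partial>M) \<le> \<epsilon>"
proof -
  let ?d = "real CARD('n)"
  obtain G where G: "\<And>x. GDERIV f x :> G x" "L-lipschitz_on UNIV G"
    using smooth by (auto simp: smooth_fun_def)
  interpret prob_space M by (rule prob)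
  interpret residual_feedback M f G L L\<^sub>0 \<alpha> \<eta> x\<^sub>1 xstar u T
    using L0_pos L_pos lipschitz convex minimizer indep uniform alpha_pos eta G
    by unfold_locales auto
  define R where "R = norm (x\<^sub>1 - xstar)"
  have d: "?d > 0" by simp
  have T: "real T > 0" using T_pos by simp
  have R: "R > 0"
    using alpha alpha_pos by (cases "R = 0") (auto simp: R_def)
  have "\<alpha> ^ 3 = R\<^sup>2 * (?d * L\<^sub>0 / (real T * L))"
    using R T d L0_pos L_pos alpha by (intro smoothing_radius_cubed) (auto simp: R_def)
  then have cube: "R\<^sup>2 * ?d * L\<^sub>0 = real T * L * \<alpha> ^ 3"
    using T L_pos by (simp add: field_simps)
  \<comment> \<open>cubing this inequality and inserting the value of \<open>\<alpha>\<close> gives the first bound on \<open>T\<close>\<close>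
  have small: "\<alpha> * ?d * L \<le> L\<^sub>0 / 16"
  proof -
    have "real T * L\<^sub>0\<^sup>2 \<ge> 2 ^ 12 * R\<^sup>2 * ?d ^ 4 * L\<^sup>2"
      using T_ge1 L0_pos unfolding R_def by (simp add: power_divide field_simps)
    then have "L * L\<^sub>0 * (2 ^ 12 * R\<^sup>2 * ?d ^ 4 * L\<^sup>2) \<le> L * L\<^sub>0 * (real T * L\<^sub>0\<^sup>2)"
      using L_pos L0_pos by (intro mult_left_mono) auto
    also have "\<dots> = real T * L * L\<^sub>0 ^ 3"
      by (simp add: power2_eq_square power3_eq_cube)
    also have "L * L\<^sub>0 * (2 ^ 12 * R\<^sup>2 * ?d ^ 4 * L\<^sup>2) = 2 ^ 12 * ?d ^ 3 * L ^ 3 * (R\<^sup>2 * ?d * L\<^sub>0)"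
      by (simp add: power2_eq_square power3_eq_cube power4_eq_xxxx)
    also have "\<dots> = real T * L * (16 * (\<alpha> * ?d * L)) ^ 3"
      unfolding cube by (simp add: power_mult_distrib)
    finally have "real T * L * (16 * (\<alpha> * ?d * L)) ^ 3 \<le> real T * L * L\<^sub>0 ^ 3" .
    then have "(16 * (\<alpha> * ?d * L)) ^ 3 \<le> L\<^sub>0 ^ 3"
      using T L_pos by simp
    then have "16 * (\<alpha> * ?d * L) \<le> L\<^sub>0"
      using L0_pos power_mono_iff[of "16 * (\<alpha> * ?d * L)" L\<^sub>0 3] alpha_pos L_pos by simp
    then show ?thesis by simp
  qed
  have "(\<Sum>t = 1..T. \<integral>\<omega>. (f (iterate t \<omega>) - f xstar) \<partial>M)
      = (\<Sum>k<T. \<integral>\<omega>. (f (iterate (Suc k) \<omega>) - f xstar) \<partial>M)"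
    by (simp only: One_nat_def sum.atLeast1_atMost_eq)
  also have "\<dots> \<le> 5 * (L * \<alpha>\<^sup>2) * real T"
    using cube by (intro expected_regret_le small) (simp add: R_def)
  also have "\<dots> \<le> \<epsilon> * real T"
  proof -
    have "10 powr (3/2) * (R\<^sup>2 * ?d * L\<^sub>0) * L powr (1/2) / \<epsilon> powr (3/2) \<le> real T"
      using T_ge2 unfolding R_def by (simp add: mult_ac)
    then have "10 * (L * \<alpha>\<^sup>2) \<le> \<epsilon>"
      by (rule accuracy_ge_of_iteration_number[OF eps_pos L_pos alpha_pos T cube])
    moreover have "0 \<le> L * \<alpha>\<^sup>2"
      using L_pos by simp
    ultimately show ?thesis
      by (intro mult_right_mono) auto
  qed
  finally show ?thesis
    using T by (simp add: field_simps)
qed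

end
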